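(* Let $\mathcal{H}$ be a Hilbert space of dimension at least two and $R>0$. Let $\Gamma\colon[0,\ell]\to\mathcal{H}$, $\ell=\operatorname{length}\Gamma$, be a rectifiable curve without self-intersections, given by its natural parametrization, such that $\operatorname{length}\Gamma\le \pi R$, and connecting points $a$ and $b$ such that $0<|a-b|<2R$. Then the following assertions are equivalent: (1) $\Gamma$ (as a set, i.e. its image) is an $R$-proximally smooth set; (2) the natural parametrization of $\Gamma$ is differentiable and its derivative is Lipschitz with constant $\frac1R$.
   Context: $|\cdot|$ is the norm of $\mathcal{H}$; $\operatorname{dist}(x,A)=\inf_{y\in A}|x-y|$. A set $A$ is $R$-proximally smooth if it is closed and $x\mapsto \operatorname{dist}(x,A)$ is continuously differentiable on $\{x: 0<\operatorname{dist}(x,A)<R\}$. Length of a curve is its total variation; a curve is rectifiable if its length is finite. The natural parametrization is the arc-length parametrization. At the endpoints of the parameter interval differentiability is one-sided. *)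

theory Defs
  imports "HOL-Analysis.Analysis"
begin

text \<open>Length as total variation: the supremum of the lengths of inscribed polygons.
  It takes the value \<open>\<infinity>\<close> for curves that are not rectifiable.  Repeated partition points are
  allowed; they contribute nothing to the sum.\<close>

definition curve_length :: "(real \<Rightarrow> 'a::metric_space) \<Rightarrow> real \<Rightarrow> real \<Rightarrow> ennreal" where
  "curve_length \<gamma> a b =
     Sup {ennreal (\<Sum>i<n. dist (\<gamma> (t i)) (\<gamma> (t (Suc i)))) | (n::nat) (t::nat \<Rightarrow> real).
            mono_on {..n} t \<and> t 0 = a \<and> t n = b}"

definition rectifiable_curve :: "(real \<Rightarrow> 'a::metric_space) \<Rightarrow> real \<Rightarrow> real \<Rightarrow> bool" where
  "rectifiable_curve \<gamma> a b \<longleftrightarrow> continuous_on {a..b} \<gamma> \<and> curve_length \<gamma> a b < \<infinity>"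

text \<open>Taking \<open>s = l\<close> shows that \<open>l\<close> is the length of the whole curve.\<close>

definition natural_parametrization :: "(real \<Rightarrow> 'a::metric_space) \<Rightarrow> real \<Rightarrow> bool" where
  "natural_parametrization \<gamma> l \<longleftrightarrow>
     0 \<le> l \<and> (\<forall>s\<in>{0..l}. curve_length \<gamma> 0 s = ennreal s)"

text \<open>Continuous Frechet differentiability on an open set \<open>U\<close>; the derivative is continuous with
  respect to the operator norm.\<close>

definition continuously_differentiable_on ::
    "('a::real_normed_vector \<Rightarrow> 'b::real_normed_vector) \<Rightarrow> 'a set \<Rightarrow> bool" where
  "continuously_differentiable_on f U \<longleftrightarrow>
     (\<exists>D :: 'a \<Rightarrow> 'a \<Rightarrow>\<^sub>L 'b.
        (\<forall>x\<in>U. (f has_derivative blinfun_apply (D x)) (at x)) \<and> continuous_on U D)"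

definition proximally_smooth :: "real \<Rightarrow> 'a::real_normed_vector set \<Rightarrow> bool" where
  "proximally_smooth R A \<longleftrightarrow>
     closed A \<and>
     continuously_differentiable_on (\<lambda>x. infdist x A) {x. 0 < infdist x A \<and> infdist x A < R}"

end

theory Submission
  imports Defs
begin

text \<open>
  Smoothness of \<open>K = \<Gamma> ` {0..l}\<close> implies regularity of \<open>\<Gamma>\<close>: differentiability of the distance
  \<open>d\<close> makes nearest points in the tube unique.  If \<open>p\<close> is nearest to \<open>x\<close>, then
  \<open>y \<mapsto> d(y)\<^sup>2 - (1 + \<kappa>) |y - x|\<^sup>2\<close> is strongly concave, and its maximiser is a point \<open>y\<close> with the same
  nearest point on the ray from \<open>p\<close> through \<open>x\<close>; iterating, the open ball of radius \<open>R\<close> touching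
  \<open>K\<close> at \<open>p\<close> in direction \<open>x - p\<close> misses \<open>K\<close>.  Hence projecting a chord of length \<open>c < 2R\<close> to \<open>K\<close>
  is Lipschitz with constant \<open>1 / (1 - c\<^sup>2/4R\<^sup>2)\<close>, which bounds the arc by the chord up to a cubic
  error, and this makes the difference quotients of \<open>\<Gamma>\<close> Cauchy.  The touching balls then bound the
  angle between chord and tangent sharply, giving the Lipschitz constant \<open>1/R\<close>.

  Conversely, the angle of \<open>\<Gamma>'\<close> with any fixed direction is \<open>1/R\<close>-Lipschitz.  Integrating against
  well-chosen directions compares \<open>\<Gamma>\<close> with a circle of radius \<open>R\<close> up to length \<open>\<pi> R\<close>: the arc stays
  outside every open ball of radius \<open>R\<close> tangent to it at its starting point.  So no point at distance
  less than \<open>R\<close> has two nearest points, and by compactness the projection is continuous.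
\<close>

section \<open>Length\<close>

lemma curve_length_le:
  fixes \<gamma> :: "real \<Rightarrow> 'a::metric_space"
  assumes "\<And>s t. a \<le> s \<Longrightarrow> s \<le> t \<Longrightarrow> t \<le> b \<Longrightarrow> dist (\<gamma> s) (\<gamma> t) \<le> \<phi> t - \<phi> s"
  shows "curve_length \<gamma> a b \<le> ennreal (\<phi> b - \<phi> a)"
  unfolding curve_length_def
proof (rule Sup_least, clarify)
  fix n :: nat and t :: "nat \<Rightarrow> real"
  assume t: "mono_on {..n} t" "a = t 0" "b = t n"
  have "(\<Sum>i<n. dist (\<gamma> (t i)) (\<gamma> (t (Suc i)))) \<le> (\<Sum>i<n. \<phi> (t (Suc i)) - \<phi> (t i))"
    using t by (intro sum_mono assms) (auto intro!: mono_onD[OF t(1)])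
  also have "\<dots> = \<phi> (t n) - \<phi> (t 0)"
    by (rule sum_lessThan_telescope)
  finally show "ennreal (\<Sum>i<n. dist (\<gamma> (t i)) (\<gamma> (t (Suc i)))) \<le> ennreal (\<phi> (t n) - \<phi> (t 0))"
    by (rule ennreal_leI)
qed

lemma partition_le_curve_length:
  assumes "mono_on {..n} t" "t 0 = a" "t n = b"
  shows "ennreal (\<Sum>i<n. dist (\<gamma> (t i)) (\<gamma> (t (Suc i)))) \<le> curve_length \<gamma> a b"
  unfolding curve_length_def using assms by (intro Sup_upper) blast

text \<open>Appending \<open>t\<close> to a partition of \<open>[0, s]\<close> gives a partition of
  \<open>[0, t]\<close>, so every polygon up to \<open>s\<close> together with the last chord has
  length at most \<open>t\<close>; then take the supremum over the partitions.\<close>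

lemma natural_dist_le:
  assumes nat: "natural_parametrization \<gamma> l" and st: "0 \<le> s" "s \<le> t" "t \<le> l"
  shows "dist (\<gamma> s) (\<gamma> t) \<le> t - s"
proof -
  have *: "(\<Sum>i<n. dist (\<gamma> (p i)) (\<gamma> (p (Suc i)))) + dist (\<gamma> s) (\<gamma> t) \<le> t"
    if p: "mono_on {..n} p" "p 0 = 0" "p n = s" for n p
  proof -
    define q where "q = (\<lambda>i. if i \<le> n then p i else t)"
    have "q i \<le> q j" if "i \<le> j" "j \<le> Suc n" for i j
    proof (cases "j \<le> n")
      case True then show ?thesis using that mono_onD[OF p(1), of i j] by (auto simp: q_def)
    next
      case False
      then show ?thesis using that mono_onD[OF p(1), of i n] p st by (auto simp: q_def)
    qed
    then have "mono_on {..Suc n} q" by (auto intro!: mono_onI)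
    then have "ennreal (\<Sum>i<Suc n. dist (\<gamma> (q i)) (\<gamma> (q (Suc i)))) \<le> curve_length \<gamma> 0 t"
      by (rule partition_le_curve_length) (auto simp: q_def p)
    also have "\<dots> = ennreal t"
      using nat st by (auto simp: natural_parametrization_def)
    finally show ?thesis
      using st p by (simp add: q_def ennreal_le_iff)
  qed
  have "ennreal s = curve_length \<gamma> 0 s"
    using nat st by (auto simp: natural_parametrization_def)
  also have "\<dots> \<le> ennreal (t - dist (\<gamma> s) (\<gamma> t))"
    unfolding curve_length_def using * by (intro Sup_least) (force intro!: ennreal_leI)
  finally have "ennreal s \<le> ennreal (t - dist (\<gamma> s) (\<gamma> t))" .
  \<comment> \<open>\<open>ennreal\<close> sends negative reals to 0, so the sign of the right-hand
    side must be known before the inequality can be read in the reals.\<close>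
  moreover have "0 \<le> t - dist (\<gamma> s) (\<gamma> t)"
  proof -
    have "mono_on {..1::nat} (\<lambda>i. if i = 0 then 0 else s)"
      using st by (auto intro!: mono_onI)
    from *[OF this] have "dist (\<gamma> 0) (\<gamma> s) + dist (\<gamma> s) (\<gamma> t) \<le> t" by simp
    then show ?thesis using zero_le_dist[of "\<gamma> 0" "\<gamma> s"] by linarith
  qed
  ultimately show ?thesis by (simp add: ennreal_le_iff)
qed

text \<open>Any majorant \<open>\<phi>\<close> of the increments on a sub-arc competes with arc length; this avoids additivity
  of \<open>curve_length\<close>.\<close>

lemma natural_le_increment:
  assumes nat: "natural_parametrization \<gamma> l" and st: "0 \<le> s" "s \<le> t" "t \<le> l"
    and \<phi>: "\<And>x y. s \<le> x \<Longrightarrow> x \<le> y \<Longrightarrow> y \<le> t \<Longrightarrow> dist (\<gamma> x) (\<gamma> y) \<le> \<phi> y - \<phi> x"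
  shows "t - s \<le> \<phi> t - \<phi> s"
proof -
  \<comment> \<open>Arc length up to \<open>s\<close> is continued by \<open>\<phi>\<close>; the
    result majorises increments on all of \<open>[0, t]\<close>, whose total length is
    known.\<close>
  define \<psi> where "\<psi> = (\<lambda>x. if x \<le> s then x else s + (\<phi> x - \<phi> s))"
  have "dist (\<gamma> x) (\<gamma> y) \<le> \<psi> y - \<psi> x" if "0 \<le> x" "x \<le> y" "y \<le> t" for x y
  proof (cases "y \<le> s \<or> s < x")
    case True
    then show ?thesis
      using that st natural_dist_le[OF nat, of x y] \<phi>[of x y] by (auto simp: \<psi>_def)
  next
    case False
    then have "dist (\<gamma> x) (\<gamma> s) \<le> s - x" "dist (\<gamma> s) (\<gamma> y) \<le> \<phi> y - \<phi> s"
      using that st natural_dist_le[OF nat, of x s] \<phi>[of s y] by auto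
    with dist_triangle[of "\<gamma> x" "\<gamma> y" "\<gamma> s"] False show ?thesis by (auto simp: \<psi>_def)
  qed
  then have "curve_length \<gamma> 0 t \<le> ennreal (\<psi> t - \<psi> 0)" by (rule curve_length_le)
  moreover have "curve_length \<gamma> 0 t = ennreal t"
    using nat st by (auto simp: natural_parametrization_def)
  moreover have "0 \<le> \<phi> t - \<phi> s"
    using \<phi>[of s t] st by (meson order.trans order_refl zero_le_dist)
  ultimately show ?thesis using st by (auto simp: \<psi>_def ennreal_le_iff split: if_splits)
qed

section \<open>Nearest points and touching balls\<close>

definition nearest :: "'a::metric_space set \<Rightarrow> 'a \<Rightarrow> 'a \<Rightarrow> bool" where
  "nearest K x p \<longleftrightarrow> p \<in> K \<and> dist x p = infdist x K"

lemma nearest_exists: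
  assumes "compact K" "K \<noteq> {}"
  obtains p where "nearest K x p"
proof -
  have "continuous_on K (\<lambda>y. dist x y)" by (intro continuous_intros)
  from continuous_attains_inf[OF assms this]
  obtain p where p: "p \<in> K" "\<And>y. y \<in> K \<Longrightarrow> dist x p \<le> dist x y" by blast
  have "dist x p \<le> infdist x K"
    using assms p by (auto simp: infdist_notempty intro!: cINF_greatest)
  with infdist_le[OF p(1), of x] have "nearest K x p" using p by (auto simp: nearest_def)
  then show thesis by (rule that)
qed

lemma has_derivative_norm_sq:
  fixes x p :: "'a::real_inner"
  shows "((\<lambda>y. (norm (y - p))\<^sup>2) has_derivative (\<lambda>v. 2 * ((x - p) \<bullet> v))) (at x)"
  unfolding power2_norm_eq_inner
  by (auto intro!: derivative_eq_intros simp: inner_commute)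

lemma norm_scaleR_diff_sq:
  fixes u w :: "'a::real_inner"
  shows "(norm (c *\<^sub>R u - w))\<^sup>2 = c\<^sup>2 * (norm u)\<^sup>2 - 2 * c * (u \<bullet> w) + (norm w)\<^sup>2"
  unfolding power2_norm_eq_inner by (simp add: inner_simps inner_commute power2_eq_square)

text \<open>The paraboloid \<open>(norm (y - p))\<^sup>2\<close> lies above the squared distance and
  touches it at \<open>x\<close>, so both have the same derivative there.\<close>

lemma infdist_sq_has_derivative:
  fixes x p :: "'a::real_inner"
  assumes "(\<lambda>y. infdist y K) differentiable (at x)" and p: "nearest K x p"
  shows "((\<lambda>y. (infdist y K)\<^sup>2) has_derivative (\<lambda>v. 2 * ((x - p) \<bullet> v))) (at x)"
proof -
  obtain D where D: "((\<lambda>y. infdist y K) has_derivative D) (at x)"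
    using assms(1) by (auto simp: differentiable_def)
  define E where "E = (\<lambda>v. 2 * infdist x K * D v)"
  have E: "((\<lambda>y. (infdist y K)\<^sup>2) has_derivative E) (at x)"
    unfolding E_def by (auto intro!: derivative_eq_intros D)
  have h: "((\<lambda>y. (norm (y - p))\<^sup>2 - (infdist y K)\<^sup>2) has_derivative
      (\<lambda>v. 2 * ((x - p) \<bullet> v) - E v)) (at x)"
    by (intro has_derivative_diff has_derivative_norm_sq E)
  have "(\<lambda>v. 2 * ((x - p) \<bullet> v) - E v) = (\<lambda>v. 0)"
  proof (rule differential_zero_maxmin[OF _ _ h])
    have "(infdist y K)\<^sup>2 \<le> (norm (y - p))\<^sup>2" for y
      using p infdist_le[of p K y] infdist_nonneg[of y K]
      by (auto simp: nearest_def dist_norm intro: power_mono)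
    moreover have "(norm (x - p))\<^sup>2 - (infdist x K)\<^sup>2 = 0"
      using p by (auto simp: nearest_def dist_norm)
    ultimately show "(\<forall>y\<in>UNIV. (norm (y - p))\<^sup>2 - (infdist y K)\<^sup>2 \<le> (norm (x - p))\<^sup>2 - (infdist x K)\<^sup>2) \<or>
      (\<forall>y\<in>UNIV. (norm (x - p))\<^sup>2 - (infdist x K)\<^sup>2 \<le> (norm (y - p))\<^sup>2 - (infdist y K)\<^sup>2)"
      by auto
  qed auto
  then have "E = (\<lambda>v. 2 * ((x - p) \<bullet> v))" by (auto simp: fun_eq_iff)
  with E show ?thesis by simp
qed

text \<open>The squared distance has gradient \<open>2 *\<^sub>R (x - p)\<close> for every nearest
  point \<open>p\<close>, and a gradient is unique.\<close>

lemma nearest_unique: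
  fixes x p :: "'a::real_inner"
  assumes "(\<lambda>y. infdist y K) differentiable (at x)" "nearest K x p" "nearest K x q"
  shows "p = q"
proof -
  have "(\<lambda>v. 2 * ((x - p) \<bullet> v)) = (\<lambda>v. 2 * ((x - q) \<bullet> v))"
    using assms by (intro has_derivative_unique[OF infdist_sq_has_derivative infdist_sq_has_derivative])
  then have "(x - p) \<bullet> v = (x - q) \<bullet> v" for v by (simp add: fun_eq_iff)
  then show ?thesis using vector_eq_rdot[of "x - p" "x - q"] by auto
qed

text \<open>A maximising sequence is Cauchy: the value at the midpoint of two near-maximisers is at
  most the supremum, so strong concavity bounds their distance. Completeness then supplies the
  maximiser.\<close>

lemma strongly_concave_attains_max:
  fixes f :: "'a::{real_inner,complete_space} \<Rightarrow> real"
  assumes cont: "continuous_on UNIV f" and bdd: "\<And>x. f x \<le> B" and "c > 0"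
    and conc: "\<And>x y. (f x + f y) / 2 + c * (norm (x - y))\<^sup>2 \<le> f ((1/2) *\<^sub>R (x + y))"
  obtains x where "\<And>y. f y \<le> f x"
proof -
  define S where "S = Sup (range f)"
  have bd: "bdd_above (range f)" using bdd by (intro bdd_aboveI[of _ B]) auto
  have S: "f x \<le> S" for x unfolding S_def using bd by (intro cSup_upper) auto
  have "\<exists>x. S - inverse (Suc n) < f x" for n :: nat
  proof -
    have "S - inverse (Suc n) < Sup (range f)" by (simp add: S_def)
    then show ?thesis using less_cSup_iff[of "range f"] bd by auto
  qed
  then obtain X where X: "\<And>n. S - inverse (Suc n) < f (X n)" by metis
  have est: "c * (norm (X m - X n))\<^sup>2 \<le> inverse (Suc N)" if "m \<ge> N" "n \<ge> N" for m n N
  proof -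
    have "inverse (real (Suc m)) \<le> inverse (Suc N)" "inverse (real (Suc n)) \<le> inverse (Suc N)"
      using that by (auto intro!: le_imp_inverse_le)
    with X[of m] X[of n] conc[of "X m" "X n"] S[of "(1/2) *\<^sub>R (X m + X n)"]
    show ?thesis by argo
  qed
  have "Cauchy X"
  proof (rule metric_CauchyI)
    fix e :: real assume "e > 0"
    then have "c * e\<^sup>2 > 0" using \<open>c > 0\<close> by simp
    then obtain N where N: "inverse (real (Suc N)) < c * e\<^sup>2" using reals_Archimedean by blast
    show "\<exists>M. \<forall>m\<ge>M. \<forall>n\<ge>M. dist (X m) (X n) < e"
    proof (intro exI allI impI)
      fix m n assume "m \<ge> N" "n \<ge> N"
      with est[of N m n] N have "c * (norm (X m - X n))\<^sup>2 < c * e\<^sup>2" by auto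
      then show "dist (X m) (X n) < e"
        using \<open>c > 0\<close> \<open>e > 0\<close> by (auto simp: dist_norm intro: power2_less_imp_less)
    qed
  qed
  then obtain x where x: "X \<longlonglongrightarrow> x" using Cauchy_convergent convergent_def by blast
  have "(\<lambda>n. f (X n)) \<longlonglongrightarrow> f x"
    using cont x by (simp add: continuous_on_tendsto_compose)
  moreover have "(\<lambda>n. S - inverse (real (Suc n))) \<longlonglongrightarrow> S"
    using tendsto_diff[OF tendsto_const LIMSEQ_inverse_real_of_nat, of S] by simp
  ultimately have "S \<le> f x"
    using X by (intro LIMSEQ_le[of _ S]) (auto intro: less_imp_le)
  then show thesis using S that order_trans by blast
qed

section \<open>Compact sets with differentiable distance in the tube of radius
  \<open>R\<close>\<close>

context
  fixes K :: "'a::{real_inner,complete_space} set" and R :: real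
  assumes K: "compact K" "K \<noteq> {}" and R: "R > 0"
    and diff: "\<And>x. 0 < infdist x K \<Longrightarrow> infdist x K < R \<Longrightarrow> (\<lambda>y. infdist y K) differentiable (at x)"
begin

text \<open>Strong concavity of \<open>f\<close> supplies the maximiser \<open>x1\<close> without compactness of balls, and the critical
  point equation puts \<open>x\<close> on the segment between \<open>x1\<close> and a nearest point of \<open>x1\<close>.\<close>

lemma infdist_extend_normal:
  assumes x: "0 < infdist x K" "infdist x K < R" and p: "nearest K x p"
    and \<mu>: "\<mu> > 0" "infdist x K * (1 + 2 * \<mu>) < R"
  shows "infdist (x + \<mu> *\<^sub>R (x - p)) K = (1 + \<mu>) * infdist x K"
proof -
  define r \<kappa> where "r = infdist x K" and "\<kappa> = 1 / \<mu>"
  have r: "0 < r" and \<kappa>: "\<kappa> > 0" "\<mu> = 1 / \<kappa>" using x \<mu> by (auto simp: r_def \<kappa>_def)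
  \<comment> \<open>With \<open>\<kappa> = 1 / \<mu>\<close> the critical point of \<open>f\<close>
    will be exactly \<open>x + \<mu> *\<^sub>R (x - p)\<close>.\<close>
  define f where "f = (\<lambda>y. (infdist y K)\<^sup>2 - (1 + \<kappa>) * (norm (y - x))\<^sup>2)"
  \<comment> \<open>This parabola bounds \<open>f\<close> from above and later confines the
    maximiser to distance \<open>2 * r * \<mu>\<close> from \<open>x\<close>.\<close>
  have up: "f y \<le> r\<^sup>2 + 2 * r * norm (y - x) - \<kappa> * (norm (y - x))\<^sup>2" for y
  proof -
    have "infdist y K \<le> r + norm (y - x)"
      using infdist_triangle[of y K x] by (simp add: r_def dist_norm)
    then have "(infdist y K)\<^sup>2 \<le> (r + norm (y - x))\<^sup>2"
      by (rule power_mono) (rule infdist_nonneg)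
    then show ?thesis by (simp add: f_def power2_eq_square algebra_simps)
  qed
  obtain x1 where max: "\<And>y. f y \<le> f x1"
  proof (rule strongly_concave_attains_max[of f "r\<^sup>2 + r\<^sup>2 / \<kappa>" "\<kappa> / 4"])
    show "continuous_on UNIV f" unfolding f_def by (intro continuous_intros)
    show "f y \<le> r\<^sup>2 + r\<^sup>2 / \<kappa>" for y
    proof -
      have "0 \<le> (r - \<kappa> * norm (y - x))\<^sup>2 / \<kappa>" using \<kappa> by simp
      also have "\<dots> = r\<^sup>2 / \<kappa> - 2 * r * norm (y - x) + \<kappa> * (norm (y - x))\<^sup>2"
        using \<kappa> by (simp add: field_simps power2_eq_square)
      finally show ?thesis using up[of y] by simp
    qed
    \<comment> \<open>With \<open>q\<close> nearest to the midpoint \<open>w\<close>, replacing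
      \<open>infdist\<close> by the distance to \<open>q\<close> changes nothing at \<open>w\<close>
      and can only raise the values at \<open>y\<close> and \<open>z\<close>. What remains is
      quadratic with leading coefficient \<open>- \<kappa>\<close>, and the parallelogram law
      evaluates it.\<close>
    show "(f y + f z) / 2 + \<kappa> / 4 * (norm (y - z))\<^sup>2 \<le> f ((1/2) *\<^sub>R (y + z))" for y z
    proof -
      define w where "w = (1/2) *\<^sub>R (y + z)"
      obtain q where q: "nearest K w q" using nearest_exists[OF K] .
      have le: "(infdist u K)\<^sup>2 \<le> (norm (u - q))\<^sup>2" for u
        using q infdist_le[of q K u] infdist_nonneg[of u K]
        by (auto simp: nearest_def dist_norm intro: power_mono)
      have eq: "(infdist w K)\<^sup>2 = (norm (w - q))\<^sup>2" using q by (auto simp: nearest_def dist_norm)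
      have par: "(norm (w - v))\<^sup>2 = ((norm (y - v))\<^sup>2 + (norm (z - v))\<^sup>2) / 2 - (norm (y - z))\<^sup>2 / 4" for v
        unfolding w_def power2_norm_eq_inner by (simp add: inner_simps inner_commute field_simps)
      have "f w = ((norm (y - q))\<^sup>2 + (norm (z - q))\<^sup>2) / 2 - (norm (y - z))\<^sup>2 / 4
        - (1 + \<kappa>) * (((norm (y - x))\<^sup>2 + (norm (z - x))\<^sup>2) / 2 - (norm (y - z))\<^sup>2 / 4)"
        by (simp add: f_def eq par)
      also have "\<dots> \<ge> (f y + f z) / 2 + \<kappa> / 4 * (norm (y - z))\<^sup>2"
        using le[of y] le[of z] by (simp add: f_def field_simps)
      finally show ?thesis by (simp add: w_def)
    qed
  qed (use \<kappa> in auto)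
  define \<delta> where "\<delta> = norm (x1 - x)"
  have "r\<^sup>2 \<le> f x1" using max[of x] by (simp add: f_def r_def)
  then have *: "\<kappa> * \<delta>\<^sup>2 \<le> 2 * r * \<delta>" and pos: "r\<^sup>2 \<le> (infdist x1 K)\<^sup>2"
    using up[of x1] \<kappa> zero_le_power2[of \<delta>] by (auto simp: \<delta>_def f_def intro: order_trans)
  have "\<delta> \<le> 2 * r * \<mu>"
  proof (cases "\<delta> = 0")
    case False
    then have "\<delta> > 0" by (simp add: \<delta>_def)
    with * have "\<kappa> * \<delta> \<le> 2 * r" by (simp add: power2_eq_square mult.assoc[symmetric])
    then have "\<mu> * (\<kappa> * \<delta>) \<le> \<mu> * (2 * r)" using \<mu> by (intro mult_left_mono) auto
    then show ?thesis using \<kappa> by (simp add: mult.commute)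
  qed (use r \<mu> in auto)
  \<comment> \<open>The hypothesis on \<open>1 + 2 * \<mu>\<close> keeps the maximiser inside the
    tube, where the distance is differentiable.\<close>
  then have lt: "infdist x1 K < R"
    using infdist_triangle[of x1 K x] \<mu> by (simp add: r_def \<delta>_def dist_norm algebra_simps)
  have gt: "0 < infdist x1 K"
    using pos r infdist_nonneg[of x1 K] by (cases "infdist x1 K = 0") auto
  obtain p1 where p1: "nearest K x1 p1" using nearest_exists[OF K] .
  have "(f has_derivative (\<lambda>v. 2 * ((x1 - p1) \<bullet> v) - (1 + \<kappa>) * (2 * ((x1 - x) \<bullet> v)))) (at x1)"
    unfolding f_def using p1 gt lt diff
    by (intro has_derivative_diff has_derivative_mult_right infdist_sq_has_derivative has_derivative_norm_sq)
  from differential_zero_maxmin[OF _ _ this, of UNIV] max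
  have crit0: "2 * ((x1 - p1) \<bullet> v) - (1 + \<kappa>) * (2 * ((x1 - x) \<bullet> v)) = 0" for v
    by (auto simp: fun_eq_iff)
  have "(x1 - p1) \<bullet> v = ((1 + \<kappa>) *\<^sub>R (x1 - x)) \<bullet> v" for v
    using crit0[of v] by (simp only: inner_scaleR_left mult.left_commute[of "1 + \<kappa>" 2])
  then have crit: "x1 - p1 = (1 + \<kappa>) *\<^sub>R (x1 - x)" using vector_eq_rdot by blast
  have "x - p1 = (x1 - p1) - (x1 - x)" by simp
  then have crit2: "x - p1 = \<kappa> *\<^sub>R (x1 - x)" by (simp only: crit) (simp add: scaleR_add_left)
  \<comment> \<open>From \<open>(1 + \<kappa>) * \<delta> = infdist x1 K \<le> infdist x K +
    \<delta>\<close> it follows that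
    \<open>dist x p1 = \<kappa> * \<delta> \<le> infdist x K\<close>: the point \<open>p1\<close> is
    nearest to \<open>x\<close> too, hence equal to \<open>p\<close>.\<close>
  have "infdist x1 K = (1 + \<kappa>) * \<delta>"
    using p1 \<kappa> by (simp add: nearest_def dist_norm crit \<delta>_def)
  moreover have "norm (x - p1) = \<kappa> * \<delta>" using \<kappa> by (simp add: crit2 \<delta>_def)
  moreover have "infdist x1 K \<le> infdist x K + \<delta>"
    using infdist_triangle[of x1 K x] by (simp add: \<delta>_def dist_norm)
  ultimately have "dist x p1 \<le> infdist x K" by (simp add: dist_norm algebra_simps)
  then have "nearest K x p1"
    using infdist_le[of p1 K x] p1 by (auto simp: nearest_def)
  then have "p1 = p" using nearest_unique[OF diff[OF x] _ p] by blast
  have "x1 - x = \<mu> *\<^sub>R (x - p)" using \<kappa> crit2 \<open>p1 = p\<close> by simp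
  then have x1: "x1 = x + \<mu> *\<^sub>R (x - p)" by (simp add: algebra_simps)
  have "infdist x1 K = norm (x1 - p)" using p1 \<open>p1 = p\<close> by (simp add: nearest_def dist_norm)
  also have "x1 - p = (1 + \<mu>) *\<^sub>R (x - p)" by (simp add: x1 algebra_simps)
  also have "norm \<dots> = (1 + \<mu>) * infdist x K"
    using p \<mu> by (simp add: nearest_def dist_norm)
  finally show ?thesis by (simp add: x1)
qed

text \<open>Continuation along the ray: the parameters \<open>c\<close> at which \<open>p\<close>
  realises the distance form a closed set \<open>C\<close>, and if its supremum stopped short of
  \<open>R / r\<close>, then \<open>infdist_extend_normal\<close> would lead beyond it.\<close>

lemma infdist_normal_ray:
  assumes x: "0 < infdist x K" "infdist x K < R" and p: "nearest K x p"
  shows "infdist (p + (R / infdist x K) *\<^sub>R (x - p)) K = R"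
proof -
  define r where "r = infdist x K"
  have r: "0 < r" "r < R" "norm (x - p) = r" using x p by (auto simp: r_def nearest_def dist_norm)
  define g where "g = (\<lambda>c. infdist (p + c *\<^sub>R (x - p)) K)"
  define C where "C = {0..R / r} \<inter> {c. g c = c * r}"
  have "closed {c. g c = c * r}"
    unfolding g_def by (intro closed_Collect_eq continuous_intros)
  then have "closed C" unfolding C_def by (intro closed_Int) auto
  have "1 \<in> C" using r by (auto simp: C_def g_def r_def field_simps)
  have bdd: "bdd_above C" by (auto simp: C_def)
  define S where "S = Sup C"
  have "S \<in> C" unfolding S_def using \<open>1 \<in> C\<close> bdd \<open>closed C\<close> by (intro closed_contains_Sup) auto
  have "S \<ge> 1" unfolding S_def using \<open>1 \<in> C\<close> bdd by (intro cSup_upper)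
  have "S = R / r"
  proof (rule ccontr)
    assume "S \<noteq> R / r"
    then have Sr: "S * r < R" using \<open>S \<in> C\<close> r by (auto simp: C_def field_simps)
    define y where "y = p + S *\<^sub>R (x - p)"
    have y: "infdist y K = S * r" using \<open>S \<in> C\<close> by (simp add: C_def g_def y_def)
    have "dist y p = S * r" using r \<open>S \<ge> 1\<close> by (simp add: y_def dist_norm)
    then have yp: "nearest K y p" using p y by (simp add: nearest_def)
    \<comment> \<open>This step size gives
      \<open>S * r * (1 + 2 * \<mu>) = (S * r + R) / 2 < R\<close>.\<close>
    define \<mu> where "\<mu> = (R - S * r) / (4 * (S * r))"
    have Srp: "S * r > 0" using r \<open>S \<ge> 1\<close> by simp
    have \<mu>: "\<mu> > 0" "(S * r) * \<mu> = (R - S * r) / 4"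
      using Srp Sr by (auto simp: \<mu>_def)
    have "infdist y K * (1 + 2 * \<mu>) < R" using \<mu> Sr by (simp add: y algebra_simps)
    from infdist_extend_normal[OF _ _ yp \<mu>(1) this]
    have "infdist (y + \<mu> *\<^sub>R (y - p)) K = (1 + \<mu>) * (S * r)" using Srp Sr y by simp
    moreover have "y + \<mu> *\<^sub>R (y - p) = p + (S * (1 + \<mu>)) *\<^sub>R (x - p)"
      by (simp add: y_def algebra_simps)
    ultimately have "g (S * (1 + \<mu>)) = S * (1 + \<mu>) * r" by (simp add: g_def mult_ac)
    moreover have "S * (1 + \<mu>) \<le> R / r"
      using \<mu> Sr r by (simp add: field_simps)
    ultimately have "S * (1 + \<mu>) \<in> C" using \<mu> \<open>S \<ge> 1\<close> by (auto simp: C_def)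
    then have "S * (1 + \<mu>) \<le> S" unfolding S_def using bdd by (intro cSup_upper)
    then show False using \<mu> \<open>S \<ge> 1\<close> by (simp add: algebra_simps mult_le_0_iff)
  qed
  with \<open>S \<in> C\<close> r show ?thesis by (simp add: C_def g_def r_def)
qed

text \<open>The open ball of radius \<open>R\<close> that touches \<open>K\<close> at
  \<open>p\<close> and has its centre \<open>y\<close> on the ray through \<open>x\<close> misses
  \<open>K\<close>; expanding \<open>R\<^sup>2 \<le> (norm (y - q))\<^sup>2\<close> gives the
  claim.\<close>

lemma proximal_normal_inequality:
  assumes x: "infdist x K < R" and p: "nearest K x p" and q: "q \<in> K"
  shows "(x - p) \<bullet> (q - p) \<le> infdist x K / (2 * R) * (norm (q - p))\<^sup>2"
proof (cases "infdist x K = 0")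
  case True
  then show ?thesis using p by (auto simp: nearest_def)
next
  case False
  define r where "r = infdist x K"
  have r: "0 < r" "norm (x - p) = r"
    using False infdist_nonneg[of x K] p by (auto simp: r_def nearest_def dist_norm)
  define y where "y = p + (R / r) *\<^sub>R (x - p)"
  have "R \<le> norm (y - q)"
    using infdist_normal_ray[OF _ x p] r infdist_le[OF q, of y] by (simp add: r_def y_def dist_norm)
  then have "R\<^sup>2 \<le> (norm (y - q))\<^sup>2" using R by (intro power_mono) auto
  also have "y - q = (R / r) *\<^sub>R (x - p) - (q - p)" by (simp add: y_def)
  also have "(norm \<dots>)\<^sup>2 = (R / r)\<^sup>2 * (norm (x - p))\<^sup>2 - 2 * (R / r) * ((x - p) \<bullet> (q - p)) + (norm (q - p))\<^sup>2"
    by (rule norm_scaleR_diff_sq)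
  also have "(R / r)\<^sup>2 * (norm (x - p))\<^sup>2 = R\<^sup>2" using r by (simp add: power_divide)
  finally have "2 * (R / r) * ((x - p) \<bullet> (q - p)) \<le> (norm (q - p))\<^sup>2" by simp
  then show ?thesis using r R by (simp add: field_simps flip: r_def)
qed

text \<open>Add the proximal normal inequality at \<open>p\<close> tested with \<open>q\<close> to
  the one at \<open>q\<close> tested with \<open>p\<close>, and apply Cauchy-Schwarz to
  \<open>(x - y) \<bullet> (p - q)\<close>.\<close>

lemma nearest_lipschitz:
  assumes x: "infdist x K \<le> \<rho>" and p: "nearest K x p"
    and y: "infdist y K \<le> \<rho>" and q: "nearest K y q" and \<rho>: "\<rho> < R"
  shows "(1 - \<rho> / R) * dist p q \<le> dist x y"
proof (cases "p = q")
  case False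
  have "(x - p) \<bullet> (q - p) \<le> \<rho> / (2 * R) * (norm (q - p))\<^sup>2"
    using proximal_normal_inequality[of x p q] assms R
    by (auto simp: nearest_def elim!: order_trans intro!: mult_right_mono divide_right_mono)
  moreover have "(y - q) \<bullet> (p - q) \<le> \<rho> / (2 * R) * (norm (p - q))\<^sup>2"
    using proximal_normal_inequality[of y q p] assms R
    by (auto simp: nearest_def elim!: order_trans intro!: mult_right_mono divide_right_mono)
  moreover have "(x - p) \<bullet> (q - p) + (y - q) \<bullet> (p - q) = (norm (p - q))\<^sup>2 - (x - y) \<bullet> (p - q)"
    unfolding power2_norm_eq_inner by (simp add: inner_simps inner_commute)
  moreover have "(x - y) \<bullet> (p - q) \<le> norm (x - y) * norm (p - q)" by (rule norm_cauchy_schwarz)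
  ultimately have "(norm (p - q))\<^sup>2 - norm (x - y) * norm (p - q) \<le> \<rho> / R * (norm (p - q))\<^sup>2"
    by (simp add: norm_minus_commute)
  then have "norm (p - q) * (norm (p - q) * (1 - \<rho> / R)) \<le> norm (p - q) * norm (x - y)"
    by (simp add: power2_eq_square algebra_simps)
  then show ?thesis using False by (simp add: dist_norm mult.commute)
qed simp

text \<open>The proximal normal inequality at the projection \<open>p'\<close> of \<open>x\<close>,
  tested with both ends and averaged with weights \<open>1 - \<kappa>\<close> and
  \<open>\<kappa>\<close>, gives \<open>d\<^sup>2 \<le> d / (2 * R) * (d\<^sup>2 + \<kappa> * (1 -
  \<kappa>) * c\<^sup>2)\<close>. The crude bounds \<open>d \<le> c / 2\<close> and
  \<open>\<kappa> * (1 - \<kappa>) \<le> 1 / 4\<close> finish the estimate.\<close>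

lemma infdist_segment:
  assumes pq: "p \<in> K" "q \<in> K" "dist p q < 2 * R" and \<kappa>: "0 \<le> \<kappa>" "\<kappa> \<le> 1"
  shows "infdist (p + \<kappa> *\<^sub>R (q - p)) K \<le> (dist p q)\<^sup>2 / (4 * R)"
proof -
  define x c where "x = p + \<kappa> *\<^sub>R (q - p)" and "c = dist p q"
  define d where "d = infdist x K"
  have "dist x p = \<kappa> * c" using \<kappa> by (simp add: x_def c_def dist_norm norm_minus_commute)
  moreover have "x - q = (1 - \<kappa>) *\<^sub>R (p - q)" by (simp add: x_def algebra_simps)
  then have "dist x q = (1 - \<kappa>) * c" using \<kappa> by (simp add: c_def dist_norm)
  ultimately have "d \<le> \<kappa> * c" "d \<le> (1 - \<kappa>) * c"
    using infdist_le[OF pq(1), of x] infdist_le[OF pq(2), of x] by (auto simp: d_def)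
  then have d: "2 * d \<le> c" by (simp add: algebra_simps)
  then have dR: "d < R" using pq by (simp add: c_def)
  have d0: "0 \<le> d" by (simp add: d_def infdist_nonneg)
  obtain p' where p': "nearest K x p'" using nearest_exists[OF K] .
  have n: "(norm (x - p'))\<^sup>2 = d\<^sup>2" using p' by (simp add: nearest_def d_def dist_norm)
  have "(1 - \<kappa>) * ((x - p') \<bullet> (p - p')) \<le> (1 - \<kappa>) * (d / (2 * R) * (norm (p - p'))\<^sup>2)"
    using proximal_normal_inequality[OF _ p' pq(1)] dR \<kappa> by (intro mult_left_mono) (auto simp: d_def)
  moreover have "\<kappa> * ((x - p') \<bullet> (q - p')) \<le> \<kappa> * (d / (2 * R) * (norm (q - p'))\<^sup>2)"
    using proximal_normal_inequality[OF _ p' pq(2)] dR \<kappa> by (intro mult_left_mono) (auto simp: d_def)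
  moreover have "(1 - \<kappa>) * ((x - p') \<bullet> (p - p')) + \<kappa> * ((x - p') \<bullet> (q - p')) = d\<^sup>2"
    unfolding n[symmetric] power2_norm_eq_inner by (simp add: x_def inner_simps inner_commute algebra_simps)
  moreover have "(1 - \<kappa>) * (norm (p - p'))\<^sup>2 + \<kappa> * (norm (q - p'))\<^sup>2 = d\<^sup>2 + \<kappa> * (1 - \<kappa>) * c\<^sup>2"
    unfolding n[symmetric] c_def dist_norm power2_norm_eq_inner
    by (simp add: x_def inner_simps inner_commute algebra_simps)
  moreover have "d / (2 * R) * ((1 - \<kappa>) * (norm (p - p'))\<^sup>2 + \<kappa> * (norm (q - p'))\<^sup>2) =
      (1 - \<kappa>) * (d / (2 * R) * (norm (p - p'))\<^sup>2) + \<kappa> * (d / (2 * R) * (norm (q - p'))\<^sup>2)"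
    by (simp add: distrib_left mult.left_commute)
  ultimately have "d\<^sup>2 \<le> d / (2 * R) * (d\<^sup>2 + \<kappa> * (1 - \<kappa>) * c\<^sup>2)"
    by (smt (verit))
  also have "\<dots> \<le> d / (2 * R) * (c\<^sup>2 / 2)"
  proof (intro mult_left_mono)
    have "d\<^sup>2 \<le> (c / 2)\<^sup>2" using d d0 by (intro power_mono) auto
    moreover have "\<kappa> * (1 - \<kappa>) \<le> 1 / 4"
      using zero_le_power2[of "\<kappa> - 1 / 2"] by (simp add: power2_eq_square algebra_simps)
    then have "\<kappa> * (1 - \<kappa>) * c\<^sup>2 \<le> 1 / 4 * c\<^sup>2" by (intro mult_right_mono) auto
    ultimately show "d\<^sup>2 + \<kappa> * (1 - \<kappa>) * c\<^sup>2 \<le> c\<^sup>2 / 2" by (simp add: power2_eq_square)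
  qed (use d0 R in auto)
  finally have *: "d * d \<le> d * (c\<^sup>2 / (4 * R))" by (simp add: power2_eq_square)
  show ?thesis
  proof (cases "d = 0")
    case True then show ?thesis using R by (simp add: d_def x_def)
  next
    case False
    with d0 have "d > 0" by simp
    from mult_left_le_imp_le[OF * this] show ?thesis by (simp add: d_def x_def c_def)
  qed
qed

end

section \<open>From chord estimates to tangents\<close>

text \<open>\<open>T x\<close> is the first time at which \<open>g\<close> reaches level
  \<open>x\<close>. Superlevel sets shrink as the level grows, so \<open>T\<close> is monotone, and
  by the intermediate value theorem \<open>g\<close> takes exactly the value \<open>x\<close>
  there.\<close>

lemma monotone_section:
  fixes g :: "real \<Rightarrow> real"
  assumes g: "continuous_on {0..1} g" "g 0 = s" "g 1 = t"
  obtains T where "\<And>x. x \<in> {s..t} \<Longrightarrow> T x \<in> {0..1}" "\<And>x. x \<in> {s..t} \<Longrightarrow> g (T x) = x"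
    "\<And>x y. x \<in> {s..t} \<Longrightarrow> y \<in> {s..t} \<Longrightarrow> x \<le> y \<Longrightarrow> T x \<le> T y"
proof -
  define C where "C = (\<lambda>x. {c \<in> {0..1}. x \<le> g c})"
  define T where "T = (\<lambda>x. Inf (C x))"
  have ne: "1 \<in> C x" if "x \<in> {s..t}" for x using that g by (auto simp: C_def)
  have bdd: "bdd_below (C x)" for x by (auto simp: C_def)
  have "closed (C x)" for x
    unfolding C_def using continuous_on_closed_Collect_le[OF continuous_on_const g(1), of x] by simp
  then have TC: "T x \<in> C x" if "x \<in> {s..t}" for x
    unfolding T_def using ne[OF that] bdd by (intro closed_contains_Inf) auto
  show thesis
  proof (rule that)
    fix x assume x: "x \<in> {s..t}"
    show "T x \<in> {0..1}" using TC[OF x] by (auto simp: C_def)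
    have "g 0 \<le> x" "x \<le> g (T x)" "0 \<le> T x" using TC[OF x] x g by (auto simp: C_def)
    moreover have "continuous_on {0..T x} g"
      using TC[OF x] by (intro continuous_on_subset[OF g(1)]) (auto simp: C_def)
    ultimately obtain c where c: "0 \<le> c" "c \<le> T x" "g c = x" using IVT'[of g 0 x "T x"] by blast
    then have "c \<in> C x" using TC[OF x] by (auto simp: C_def)
    then have "T x \<le> c" unfolding T_def using bdd by (intro cInf_lower)
    with c show "g (T x) = x" by (metis order_antisym)
  next
    fix x y assume "x \<in> {s..t}" "y \<in> {s..t}" "x \<le> y"
    then show "T x \<le> T y"
      unfolding T_def using ne[of y] bdd by (intro cInf_superset_mono) (auto simp: C_def)
  qed
qed

text \<open>The projection of the chord is a path in the arc with the same endpoints, so by the intermediate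
  value theorem it passes monotonically ordered through all points of the sub-arc.\<close>

lemma arc_le_of_chord:
  fixes \<gamma> :: "real \<Rightarrow> 'a::{real_inner,complete_space}"
  assumes nat: "natural_parametrization \<gamma> l" and cont: "continuous_on {0..l} \<gamma>" and inj: "inj_on \<gamma> {0..l}"
    and R: "R > 0"
    and diff: "\<And>x. 0 < infdist x (\<gamma> ` {0..l}) \<Longrightarrow> infdist x (\<gamma> ` {0..l}) < R \<Longrightarrow>
      (\<lambda>y. infdist y (\<gamma> ` {0..l})) differentiable (at x)"
    and st: "0 \<le> s" "s \<le> t" "t \<le> l" and chord: "dist (\<gamma> s) (\<gamma> t) < 2 * R"
  shows "(t - s) * (1 - (dist (\<gamma> s) (\<gamma> t))\<^sup>2 / (4 * R\<^sup>2)) \<le> dist (\<gamma> s) (\<gamma> t)"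
proof -
  define K c where "K = \<gamma> ` {0..l}" and "c = dist (\<gamma> s) (\<gamma> t)"
  define \<rho> where "\<rho> = c\<^sup>2 / (4 * R)"
  have K: "compact K" "K \<noteq> {}"
    using cont st unfolding K_def by (auto intro: compact_continuous_image)
  note diff = diff[folded K_def]
  have c: "0 \<le> c" "c < 2 * R" using chord by (auto simp: c_def)
  have "c\<^sup>2 < (2 * R)\<^sup>2" using c by (intro power_strict_mono) auto
  then have \<rho>: "\<rho> < R" using R by (simp add: \<rho>_def power2_eq_square field_simps)
  define k where "k = 1 - \<rho> / R"
  have k: "k > 0" using \<rho> R by (simp add: k_def)
  have in_K: "\<gamma> s \<in> K" "\<gamma> t \<in> K" using st by (auto simp: K_def)
  define x where "x = (\<lambda>\<mu>. \<gamma> s + \<mu> *\<^sub>R (\<gamma> t - \<gamma> s))"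
  have "\<exists>p. nearest K (x \<mu>) p" for \<mu> using nearest_exists[OF K] by metis
  then obtain P where P: "\<And>\<mu>. nearest K (x \<mu>) (P \<mu>)" by metis
  have inf: "infdist (x \<mu>) K \<le> \<rho>" if "\<mu> \<in> {0..1}" for \<mu>
    using infdist_segment[OF K R diff in_K chord, of \<mu>] that by (simp add: x_def \<rho>_def c_def)
  have lip: "k * dist (P \<mu>) (P \<nu>) \<le> c * \<bar>\<mu> - \<nu>\<bar>" if "\<mu> \<in> {0..1}" "\<nu> \<in> {0..1}" for \<mu> \<nu>
  proof -
    have "k * dist (P \<mu>) (P \<nu>) \<le> dist (x \<mu>) (x \<nu>)"
      unfolding k_def using that by (intro nearest_lipschitz[OF K R diff] inf P \<rho>)
    also have "x \<mu> - x \<nu> = (\<mu> - \<nu>) *\<^sub>R (\<gamma> t - \<gamma> s)" by (simp add: x_def algebra_simps)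
    then have "dist (x \<mu>) (x \<nu>) = c * \<bar>\<mu> - \<nu>\<bar>" by (simp add: dist_norm c_def norm_minus_commute)
    finally show ?thesis .
  qed
  have "(c / k)-lipschitz_on {0..1} P"
  proof (rule lipschitz_onI)
    show "dist (P \<mu>) (P \<nu>) \<le> c / k * dist \<mu> \<nu>" if "\<mu> \<in> {0..1}" "\<nu> \<in> {0..1}" for \<mu> \<nu>
      using lip[OF that] k by (simp add: dist_real_def pos_le_divide_eq mult.commute)
  qed (use c k in auto)
  then have contP: "continuous_on {0..1} P" by (rule lipschitz_on_continuous_on)
  have "P 0 = \<gamma> s" "P 1 = \<gamma> t"
    using P[of 0] P[of 1] in_K by (auto simp: nearest_def x_def)
  \<comment> \<open>Injectivity and compactness make the inverse of \<open>\<gamma>\<close>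
    continuous, so the projected chord becomes a continuous path of parameters from \<open>s\<close>
    to \<open>t\<close>.\<close>
  define h where "h = inv_into {0..l} \<gamma>"
  have h: "h (\<gamma> \<tau>) = \<tau>" if "\<tau> \<in> {0..l}" for \<tau> using that inj by (simp add: h_def)
  have conth: "continuous_on K h"
    unfolding K_def using cont h by (intro continuous_on_inv) auto
  have PK: "P ` {0..1} \<subseteq> K" using P by (auto simp: nearest_def)
  have contg: "continuous_on {0..1} (\<lambda>\<mu>. h (P \<mu>))"
    by (rule continuous_on_compose2[OF conth contP PK])
  have \<gamma>h: "\<gamma> (h (P \<mu>)) = P \<mu>" for \<mu>
  proof -
    obtain \<tau> where "\<tau> \<in> {0..l}" "P \<mu> = \<gamma> \<tau>"
      using P[of \<mu>] by (auto simp: nearest_def K_def)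
    then show ?thesis using h by simp
  qed
  have "h (P 0) = s" "h (P 1) = t" using st \<open>P 0 = \<gamma> s\<close> \<open>P 1 = \<gamma> t\<close> by (auto simp: h)
  from monotone_section[OF contg this] obtain T where
    T: "\<And>y. y \<in> {s..t} \<Longrightarrow> T y \<in> {0..1}" "\<And>y. y \<in> {s..t} \<Longrightarrow> h (P (T y)) = y"
    "\<And>y z. y \<in> {s..t} \<Longrightarrow> z \<in> {s..t} \<Longrightarrow> y \<le> z \<Longrightarrow> T y \<le> T z" by blast
  \<comment> \<open>\<open>c / k\<close> is the Lipschitz constant of the projected chord and
    \<open>T\<close> takes values in the unit interval, so this majorant grows by at most
    \<open>c / k\<close> along the arc.\<close>
  have "t - s \<le> c / k * T t - c / k * T s"
  proof (rule natural_le_increment[OF nat st])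
    fix y z assume yz: "s \<le> y" "y \<le> z" "z \<le> t"
    then have m: "y \<in> {s..t}" "z \<in> {s..t}" by auto
    have "\<gamma> y = P (T y)" "\<gamma> z = P (T z)" 
      using T(2)[OF m(1)] T(2)[OF m(2)] \<gamma>h[of "T y"] \<gamma>h[of "T z"] by simp_all
    moreover have "k * dist (P (T y)) (P (T z)) \<le> c * (T z - T y)"
      using lip[OF T(1)[OF m(1)] T(1)[OF m(2)]] T(3)[OF m yz(2)] by simp
    ultimately show "dist (\<gamma> y) (\<gamma> z) \<le> c / k * T z - c / k * T y"
      using k by (simp add: field_simps)
  qed
  also have "\<dots> = c / k * (T t - T s)" by (simp add: algebra_simps)
  also have "\<dots> \<le> c / k * 1"
    using T(1)[of s] T(1)[of t] st c k by (intro mult_left_mono) auto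
  finally have "(t - s) * k \<le> c" using k by (simp add: field_simps)
  then show ?thesis by (simp add: k_def \<rho>_def c_def power2_eq_square mult.assoc)
qed

section \<open>Convergence of difference quotients when chords nearly match arcs\<close>

context
  fixes \<gamma> :: "real \<Rightarrow> 'a::{real_inner,complete_space}" and l C \<eta> :: real
  assumes l: "0 < l" and C: "C \<ge> 0" and \<eta>: "\<eta> > 0"
    and upper: "\<And>x y. x \<in> {0..l} \<Longrightarrow> y \<in> {0..l} \<Longrightarrow> norm (\<gamma> x - \<gamma> y) \<le> \<bar>x - y\<bar>"
    and lower: "\<And>x y. x \<in> {0..l} \<Longrightarrow> y \<in> {0..l} \<Longrightarrow> \<bar>x - y\<bar> \<le> \<eta> \<Longrightarrow>
      (x - y)\<^sup>2 - C * (x - y)^4 \<le> (norm (\<gamma> x - \<gamma> y))\<^sup>2"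
begin

definition slope :: "real \<Rightarrow> real \<Rightarrow> 'a" where
  "slope x y = (1 / (y - x)) *\<^sub>R (\<gamma> y - \<gamma> x)"

lemma slope_commute: "slope x y = slope y x"
proof -
  have "1 / (y - x) = - (1 / (x - y))" by (metis minus_diff_eq minus_divide_right)
  then show ?thesis
    unfolding slope_def by (simp only: scaleR_minus_left minus_diff_eq flip: scaleR_minus_right)
qed

text \<open>Stewart's identity for the deviation \<open>e\<close> of \<open>\<gamma> m\<close> from
  the corresponding point of the chord: the two partial chords are at most their parameter lengths
  while the full chord nearly attains its own, so \<open>norm e\<close> is of order
  \<open>\<delta>\<^sup>2\<close>. The restriction \<open>1 / 2 \<le> \<mu>\<close> controls the
  division by \<open>\<mu> * \<delta>\<close>.\<close>

lemma slope_half: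
  assumes p: "p \<in> {0..l}" and q: "q \<in> {0..l}" and pq: "p \<noteq> q" "\<bar>q - p\<bar> \<le> \<eta>" and \<mu>: "1 / 2 \<le> \<mu>" "\<mu> \<le> 1"
  shows "norm (slope p (p + \<mu> * (q - p)) - slope p q) \<le> sqrt C * \<bar>q - p\<bar>"
proof -
  define m \<delta> where "m = p + \<mu> * (q - p)" and "\<delta> = \<bar>q - p\<bar>"
  have \<delta>: "\<delta> > 0" using pq by (simp add: \<delta>_def)
  have m: "m \<in> {0..l}"
  proof -
    have "m = (1 - \<mu>) *\<^sub>R p + \<mu> *\<^sub>R q" by (simp add: m_def algebra_simps)
    then show ?thesis using convexD[OF convex_real_interval(5) p q, of "1 - \<mu>" \<mu>] \<mu> by simp
  qed
  define e where "e = \<gamma> m - \<gamma> p - \<mu> *\<^sub>R (\<gamma> q - \<gamma> p)"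
  have "(norm e)\<^sup>2 = (1 - \<mu>) * (norm (\<gamma> m - \<gamma> p))\<^sup>2 + \<mu> * (norm (\<gamma> m - \<gamma> q))\<^sup>2
      - \<mu> * (1 - \<mu>) * (norm (\<gamma> p - \<gamma> q))\<^sup>2"
    unfolding e_def power2_norm_eq_inner by (simp add: inner_simps inner_commute algebra_simps)
  also have "\<dots> \<le> (1 - \<mu>) * (\<mu> * \<delta>)\<^sup>2 + \<mu> * ((1 - \<mu>) * \<delta>)\<^sup>2 - \<mu> * (1 - \<mu>) * (\<delta>\<^sup>2 - C * \<delta>^4)"
  proof -
    have "norm (\<gamma> m - \<gamma> p) \<le> \<mu> * \<delta>"
      using upper[OF m p] \<mu> by (simp add: m_def \<delta>_def abs_mult)
    then have 1: "(norm (\<gamma> m - \<gamma> p))\<^sup>2 \<le> (\<mu> * \<delta>)\<^sup>2" by (intro power_mono) auto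
    have "m - q = (1 - \<mu>) * (p - q)" by (simp add: m_def algebra_simps)
    then have "norm (\<gamma> m - \<gamma> q) \<le> (1 - \<mu>) * \<delta>"
      using upper[OF m q] \<mu> by (simp add: \<delta>_def abs_mult abs_minus_commute)
    then have 2: "(norm (\<gamma> m - \<gamma> q))\<^sup>2 \<le> ((1 - \<mu>) * \<delta>)\<^sup>2" by (intro power_mono) auto
    have 3: "\<delta>\<^sup>2 - C * \<delta>^4 \<le> (norm (\<gamma> p - \<gamma> q))\<^sup>2"
      using lower[OF q p] pq by (simp add: \<delta>_def norm_minus_commute)
    show ?thesis using \<mu> 1 2 3
      by (intro diff_mono add_mono mult_left_mono) auto
  qed
  also have "\<dots> = \<mu> * (1 - \<mu>) * (C * \<delta>^4)"
    by (simp add: algebra_simps power2_eq_square power4_eq_xxxx)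
  also have "\<dots> \<le> 1 / 4 * (C * \<delta>^4)"
  proof (intro mult_right_mono)
    show "\<mu> * (1 - \<mu>) \<le> 1 / 4"
      using zero_le_power2[of "\<mu> - 1 / 2"] by (simp add: power2_eq_square algebra_simps)
  qed (use C in auto)
  also have "\<dots> = (sqrt C * \<delta>\<^sup>2 / 2)\<^sup>2"
    using C by (simp add: power2_eq_square power4_eq_xxxx)
  finally have e: "norm e \<le> sqrt C * \<delta>\<^sup>2 / 2"
    by (rule power2_le_imp_le) (use C in auto)
  have "slope p m - slope p q = (1 / (\<mu> * (q - p))) *\<^sub>R e"
    using \<mu> pq by (simp add: slope_def m_def e_def scaleR_diff_right)
  then have "norm (slope p m - slope p q) = norm e / (\<mu> * \<delta>)"
    using \<mu> by (simp add: \<delta>_def abs_mult)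
  also have "\<dots> \<le> (sqrt C * \<delta>\<^sup>2 / 2) / (1 / 2 * \<delta>)"
    using e \<mu> \<delta> C by (intro frac_le mult_right_mono mult_pos_pos) auto
  also have "\<dots> = sqrt C * \<delta>" using \<delta> by (simp add: power2_eq_square)
  finally show ?thesis by (simp add: m_def \<delta>_def)
qed

text \<open>Repeated halving of the interval: each halving costs half as much as the one before, and
  the geometric series gives the factor 2. The induction runs on the number \<open>k\<close> of
  halvings needed to reach \<open>\<mu>\<close>.\<close>

lemma slope_same_side:
  assumes p: "p \<in> {0..l}" and q: "q \<in> {0..l}" and pq: "p \<noteq> q" "\<bar>q - p\<bar> \<le> \<eta>" and \<mu>: "0 < \<mu>" "\<mu> \<le> 1"
  shows "norm (slope p (p + \<mu> * (q - p)) - slope p q) \<le> 2 * sqrt C * \<bar>q - p\<bar>"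
proof -
  have "norm (slope p (p + \<mu> * (q - p)) - slope p q) \<le> 2 * sqrt C * \<bar>q - p\<bar>"
    if "(1 / 2) ^ k \<le> \<mu>" "\<mu> \<le> 1" "q \<in> {0..l}" "p \<noteq> q" "\<bar>q - p\<bar> \<le> \<eta>" for k \<mu> q
    using that
  proof (induction k arbitrary: \<mu> q)
    case 0
    then show ?case using C by simp
  next
    case (Suc k)
    have half: "norm (slope p (p + \<nu> * (q - p)) - slope p q) \<le> sqrt C * \<bar>q - p\<bar>"
      if "1 / 2 \<le> \<nu>" "\<nu> \<le> 1" for \<nu>
      using that Suc.prems p by (intro slope_half) auto
    show ?case
    proof (cases "1 / 2 \<le> \<mu>")
      case True
      have "sqrt C * \<bar>q - p\<bar> \<ge> 0" using C by simp
      then show ?thesis using half[OF True Suc.prems(2)] by linarith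
    next
      case False
      define q' where "q' = p + 1 / 2 * (q - p)"
      have "q' \<in> {0..l}" using p Suc.prems by (auto simp: q'_def field_simps)
      moreover have "q' - p = (q - p) / 2" by (simp add: q'_def)
      ultimately have "norm (slope p (p + 2 * \<mu> * (q' - p)) - slope p q') \<le> 2 * sqrt C * \<bar>q' - p\<bar>"
        using Suc.prems False by (intro Suc.IH) auto
      moreover have "p + 2 * \<mu> * (q' - p) = p + \<mu> * (q - p)" by (simp add: q'_def)
      moreover have "\<bar>q' - p\<bar> = \<bar>q - p\<bar> / 2" by (simp add: q'_def)
      ultimately have "norm (slope p (p + \<mu> * (q - p)) - slope p q') \<le> sqrt C * \<bar>q - p\<bar>" by simp
      moreover have "norm (slope p q' - slope p q) \<le> sqrt C * \<bar>q - p\<bar>"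
        using half[of "1 / 2"] by (simp add: q'_def)
      ultimately show ?thesis
        using norm_triangle_ineq[of "slope p (p + \<mu> * (q - p)) - slope p q'" "slope p q' - slope p q"]
        by simp
    qed
  qed
  moreover obtain k where "(1 / 2) ^ k < \<mu>" using real_arch_pow_inv[of \<mu> "1 / 2"] \<mu> by auto
  ultimately show ?thesis using assms by (meson less_imp_le)
qed

lemma slope_between:
  assumes "p \<in> {0..l}" "q \<in> {0..l}" "p \<noteq> q" "\<bar>q - p\<bar> \<le> \<eta>" and m: "p < m \<and> m \<le> q \<or> q \<le> m \<and> m < p"
  shows "norm (slope p m - slope p q) \<le> 2 * sqrt C * \<bar>q - p\<bar>"
proof -
  define \<mu> where "\<mu> = (m - p) / (q - p)"
  have "0 < \<mu>" "\<mu> \<le> 1" "m = p + \<mu> * (q - p)"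
    using m assms(3) by (auto simp: \<mu>_def field_simps zero_less_divide_iff divide_le_eq)
  then show ?thesis using slope_same_side[of p q \<mu>] assms by simp
qed

text \<open>On one side of \<open>s\<close> this follows from \<open>slope_between\<close>. On
  opposite sides both slopes are compared with the slope over an interval \<open>[a, b]\<close>
  centred at \<open>s\<close>, which by \<open>slope_half\<close> is close to the slopes over its
  two halves; this makes four errors of at most \<open>2 * sqrt C * h\<close> each.\<close>

lemma slope_cauchy:
  assumes s: "s \<in> {0..l}" and q: "q \<in> {0..l}" "q \<noteq> s" "\<bar>q - s\<bar> \<le> h"
    and q': "q' \<in> {0..l}" "q' \<noteq> s" "\<bar>q' - s\<bar> \<le> h" and h: "2 * h \<le> \<eta>"
  shows "norm (slope s q - slope s q') \<le> 8 * sqrt C * h"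
proof -
  have sC: "sqrt C \<ge> 0" using C by simp
  have h0: "h \<ge> 0" using q by simp
  have le: "2 * sqrt C * \<bar>y - s\<bar> \<le> 2 * sqrt C * h" if "\<bar>y - s\<bar> \<le> h" for y
    using that sC by (intro mult_left_mono) auto
  have hh: "2 * sqrt C * h \<ge> 0" using sC h0 by simp
  have opp: "norm (slope s x - slope s y) \<le> 8 * sqrt C * h"
    if "x \<in> {0..l}" "y \<in> {0..l}" "x < s" "s < y" "s - x \<le> h" "y - s \<le> h" for x y
  proof -
    define k where "k = min (s - x) (y - s)"
    define a b where "a = s - k" and "b = s + k"
    have k: "k > 0" "k \<le> h" "x \<le> a" "b \<le> y" using that by (auto simp: k_def a_def b_def)
    then have ab: "a \<in> {0..l}" "b \<in> {0..l}" "a < s" "s < b" "b - a = 2 * k"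
      using that s by (auto simp: a_def b_def)
    have "norm (slope s a - slope s x) \<le> 2 * sqrt C * h"
      using slope_between[of s x a] le[of x] that ab k s h by auto
    moreover have "norm (slope s b - slope s y) \<le> 2 * sqrt C * h"
      using slope_between[of s y b] le[of y] that ab k s h by auto
    moreover have "norm (slope a (a + 1 / 2 * (b - a)) - slope a b) \<le> sqrt C * \<bar>b - a\<bar>"
      using ab k h by (intro slope_half) auto
    then have "norm (slope s a - slope a b) \<le> sqrt C * (2 * k)"
      using ab k by (simp add: slope_commute[of s a]) (simp add: a_def)
    moreover have "norm (slope b (b + 1 / 2 * (a - b)) - slope b a) \<le> sqrt C * \<bar>a - b\<bar>"
      using ab k h by (intro slope_half) auto
    then have "norm (slope s b - slope a b) \<le> sqrt C * (2 * k)"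
      using ab k by (simp add: slope_commute[of s b] slope_commute[of a b]) (simp add: b_def a_def)
    moreover have "sqrt C * (2 * k) \<le> 2 * sqrt C * h" 
    using k mult_left_mono[OF _ sC, of "2 * k" "2 * h"] by simp
    moreover have "norm (slope s x - slope s y) \<le> norm (slope s a - slope s x) + norm (slope s a - slope a b)
      + norm (slope s b - slope a b) + norm (slope s b - slope s y)"
      using dist_triangle[of "slope s x" "slope s y" "slope s a"]
        dist_triangle[of "slope s a" "slope s y" "slope a b"]
        dist_triangle[of "slope a b" "slope s y" "slope s b"]
      by (simp add: dist_norm norm_minus_commute)
    ultimately show ?thesis by linarith
  qed
  consider "q < s" "q' < s" "q \<le> q'" | "q < s" "q' < s" "q' \<le> q" | "s < q" "s < q'" "q \<le> q'"
    | "s < q" "s < q'" "q' \<le> q" | "q < s" "s < q'" | "q' < s" "s < q"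
    using q q' by linarith
  then show ?thesis
  proof cases
    case 1
    then have "norm (slope s q' - slope s q) \<le> 2 * sqrt C * \<bar>q - s\<bar>"
      using s q h h0 by (intro slope_between) auto
    with le[OF q(3)] hh show ?thesis by (subst norm_minus_commute) linarith
  next
    case 2
    then have "norm (slope s q - slope s q') \<le> 2 * sqrt C * \<bar>q' - s\<bar>"
      using s q' h h0 by (intro slope_between) auto
    with le[OF q'(3)] hh show ?thesis by linarith
  next
    case 3
    then have "norm (slope s q - slope s q') \<le> 2 * sqrt C * \<bar>q' - s\<bar>"
      using s q' h h0 by (intro slope_between) auto
    with le[OF q'(3)] hh show ?thesis by linarith
  next
    case 4
    then have "norm (slope s q' - slope s q) \<le> 2 * sqrt C * \<bar>q - s\<bar>"
      using s q h h0 by (intro slope_between) auto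
    with le[OF q(3)] hh show ?thesis by (subst norm_minus_commute) linarith
  next
    case 5 then show ?thesis using opp[of q q'] q q' by auto
  next
    case 6 then show ?thesis using opp[of q' q] q q' by (auto simp: norm_minus_commute)
  qed
qed

text \<open>By \<open>slope_cauchy\<close> the slopes at \<open>s\<close> converge along a sequence
  tending to \<open>s\<close>; passing to the limit in one argument of the same estimate gives the
  quadratic error. The two chord bounds squeeze the norm of the limit to 1.\<close>

lemma tangent_exists:
  assumes s: "s \<in> {0..l}"
  obtains u where "norm u = 1"
    "\<And>q. q \<in> {0..l} \<Longrightarrow> 2 * \<bar>q - s\<bar> \<le> \<eta> \<Longrightarrow> norm (\<gamma> q - \<gamma> s - (q - s) *\<^sub>R u) \<le> 8 * sqrt C * (q - s)\<^sup>2"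
proof -
  \<comment> \<open>\<open>q0\<close> is an endpoint other than \<open>s\<close>, so
    \<open>X\<close> approaches \<open>s\<close> inside the interval even when \<open>s\<close> is
    itself an endpoint.\<close>
  define q0 where "q0 = (if s = 0 then l else 0)"
  define X where "X = (\<lambda>n. s + inverse (real (Suc n)) * (q0 - s))"
  have q0: "q0 \<in> {0..l}" "q0 \<noteq> s" using l by (auto simp: q0_def)
  have X: "X n \<in> {0..l}" "X n \<noteq> s" for n
  proof -
    define \<mu> where "\<mu> = inverse (real (Suc n))"
    have \<mu>: "0 < \<mu>" "\<mu> \<le> 1" by (auto simp: \<mu>_def field_simps)
    have "X n = (1 - \<mu>) *\<^sub>R s + \<mu> *\<^sub>R q0" by (simp add: X_def \<mu>_def algebra_simps)
    then show "X n \<in> {0..l}" using convexD[OF convex_real_interval(5) s q0(1), of "1 - \<mu>" \<mu>] \<mu> by simp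
    show "X n \<noteq> s" using q0 by (simp add: X_def)
  qed
  have "(\<lambda>n. s + inverse (real (Suc n)) * (q0 - s)) \<longlonglongrightarrow> s + 0 * (q0 - s)"
    by (intro tendsto_intros LIMSEQ_inverse_real_of_nat)
  then have Xlim: "X \<longlonglongrightarrow> s" by (simp add: X_def)
  have ev: "\<forall>\<^sub>F n in sequentially. \<bar>X n - s\<bar> \<le> h" if "h > 0" for h
    using tendstoD[OF Xlim that] by (rule eventually_mono) (auto simp: dist_real_def)
  have "Cauchy (\<lambda>n. slope s (X n))"
  proof (rule metric_CauchyI)
    fix e :: real assume e: "e > 0"
    define h where "h = min (\<eta> / 2) (e / (8 * sqrt C + 1))"
    have sC: "8 * sqrt C + 1 > 0" "sqrt C \<ge> 0" using C by (auto intro: add_nonneg_pos)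
    have h: "h > 0" using \<eta> divide_pos_pos[OF e sC(1)] by (simp add: h_def)
    have "h \<le> e / (8 * sqrt C + 1)" by (simp add: h_def)
    then have he: "(8 * sqrt C + 1) * h \<le> e" using sC by (simp add: field_simps)
    obtain N where "\<And>n. n \<ge> N \<Longrightarrow> \<bar>X n - s\<bar> \<le> h"
      using ev[OF h] by (auto simp: eventually_sequentially)
    then have "norm (slope s (X m) - slope s (X n)) \<le> 8 * sqrt C * h" if "m \<ge> N" "n \<ge> N" for m n
      using that by (intro slope_cauchy s X) (auto simp: h_def)
    moreover have "8 * sqrt C * h < e" using he h by (simp add: algebra_simps)
    ultimately show "\<exists>M. \<forall>m\<ge>M. \<forall>n\<ge>M. dist (slope s (X m)) (slope s (X n)) < e"
      by (intro exI[of _ N]) (auto simp: dist_norm intro: le_less_trans)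
  qed
  then obtain u where u: "(\<lambda>n. slope s (X n)) \<longlonglongrightarrow> u" using Cauchy_convergent convergent_def by blast
  show thesis
  proof (rule that)
    have nsl: "norm (slope s (X n)) = norm (\<gamma> (X n) - \<gamma> s) / \<bar>X n - s\<bar>" for n
      by (simp add: slope_def)
    have "(\<lambda>n. (norm (slope s (X n)))\<^sup>2) \<longlonglongrightarrow> 1"
    proof (rule real_tendsto_sandwich)
      show "\<forall>\<^sub>F n in sequentially. 1 - C * (X n - s)\<^sup>2 \<le> (norm (slope s (X n)))\<^sup>2"
        using ev[OF \<eta>]
      proof (rule eventually_mono)
        fix n assume "\<bar>X n - s\<bar> \<le> \<eta>"
        from lower[OF X(1) s this] have "(X n - s)\<^sup>2 * (1 - C * (X n - s)\<^sup>2) \<le> (norm (\<gamma> (X n) - \<gamma> s))\<^sup>2"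
          by (simp add: algebra_simps power2_eq_square power4_eq_xxxx)
        then show "1 - C * (X n - s)\<^sup>2 \<le> (norm (slope s (X n)))\<^sup>2"
          using X(2)[of n] unfolding nsl power_divide power2_abs
          by (subst pos_le_divide_eq) (auto simp: mult.commute)
      qed
      show "\<forall>\<^sub>F n in sequentially. (norm (slope s (X n)))\<^sup>2 \<le> 1"
        using X upper[OF X(1) s] unfolding nsl
        by (intro always_eventually allI power_le_one) (auto simp: divide_le_eq)
      show "(\<lambda>n. 1 - C * (X n - s)\<^sup>2) \<longlonglongrightarrow> 1"
        by (rule tendsto_eq_intros Xlim refl | simp)+
    qed simp
    moreover have "(\<lambda>n. (norm (slope s (X n)))\<^sup>2) \<longlonglongrightarrow> (norm u)\<^sup>2" by (intro tendsto_intros u)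
    ultimately have "(norm u)\<^sup>2 = 1" using LIMSEQ_unique by blast
    then show "norm u = 1" using power2_eq_imp_eq[of "norm u" 1] by simp
  next
    fix q assume q: "q \<in> {0..l}" "2 * \<bar>q - s\<bar> \<le> \<eta>"
    show "norm (\<gamma> q - \<gamma> s - (q - s) *\<^sub>R u) \<le> 8 * sqrt C * (q - s)\<^sup>2"
    proof (cases "q = s")
      case False
      define h where "h = \<bar>q - s\<bar>"
      have h: "h > 0" using False by (simp add: h_def)
      have "norm (slope s q - u) \<le> 8 * sqrt C * h"
      proof (rule tendsto_upperbound)
        show "(\<lambda>n. norm (slope s q - slope s (X n))) \<longlonglongrightarrow> norm (slope s q - u)"
          by (intro tendsto_intros u)
        show "\<forall>\<^sub>F n in sequentially. norm (slope s q - slope s (X n)) \<le> 8 * sqrt C * h"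
          using ev[OF h] by (rule eventually_mono) (use q False s X in \<open>auto intro!: slope_cauchy simp: h_def\<close>)
      qed simp
      then have "h * norm (slope s q - u) \<le> h * (8 * sqrt C * h)" using h by (intro mult_left_mono) auto
      moreover have "\<gamma> q - \<gamma> s - (q - s) *\<^sub>R u = (q - s) *\<^sub>R (slope s q - u)"
        using False by (simp add: slope_def scaleR_diff_right)
      then have "norm (\<gamma> q - \<gamma> s - (q - s) *\<^sub>R u) = h * norm (slope s q - u)" by (simp add: h_def)
      ultimately have "norm (\<gamma> q - \<gamma> s - (q - s) *\<^sub>R u) \<le> 8 * sqrt C * (h * h)" by (simp add: mult_ac)
      moreover have "h * h = (q - s)\<^sup>2" by (simp add: h_def power2_eq_square)
      ultimately show ?thesis by simp
    qed simp
  qed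
qed

end

text \<open>The deviation is the sine of the angle between \<open>e\<close> and \<open>v\<close>,
  while \<open>norm (e - v)\<close> is the chord of that angle. They agree to first order; keeping
  the leading constant 1 is what makes the later Lipschitz constant sharp.\<close>

lemma norm_diff_le_of_deviation:
  fixes e v :: "'a::real_inner"
  assumes e: "norm e = 1" and v: "norm v = 1" and pos: "e \<bullet> v > 0"
    and dev: "norm (e - (e \<bullet> v) *\<^sub>R v) \<le> \<eta>" and \<eta>: "\<eta> \<le> 1"
  shows "norm (e - v) \<le> \<eta> * (1 + \<eta>)"
proof -
  define a where "a = e \<bullet> v"
  have \<eta>0: "0 \<le> \<eta>" using dev norm_ge_zero order_trans by blast
  have ev: "e \<bullet> e = 1" "v \<bullet> v = 1" using e v by (simp_all add: dot_square_norm)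
  have a: "0 < a" "a \<le> 1" using pos norm_cauchy_schwarz[of e v] e v by (simp_all add: a_def)
  have "(norm (e - a *\<^sub>R v))\<^sup>2 = 1 - a\<^sup>2"
    unfolding power2_norm_eq_inner using ev
    by (simp add: inner_simps inner_commute a_def power2_eq_square)
  moreover have "(norm (e - a *\<^sub>R v))\<^sup>2 \<le> \<eta>\<^sup>2" using dev by (intro power_mono) (auto simp: a_def)
  ultimately have 1: "1 - a\<^sup>2 \<le> \<eta>\<^sup>2" by simp
  have "a\<^sup>2 \<le> a" using a by (simp add: power2_eq_square)
  have \<eta>1: "\<eta>\<^sup>2 \<le> 1" using \<eta> \<eta>0 by (simp add: power_le_one)
  \<comment> \<open>This emulates dividing \<open>(1 + a) * (1 - a) \<le> \<eta>\<^sup>2\<close> by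
    \<open>1 + a \<ge> 2 - \<eta>\<^sup>2\<close>, with \<open>1 + \<eta>\<^sup>2\<close> as a bound
    for twice the reciprocal.\<close>
  have "2 * (1 - a) \<le> ((1 + \<eta>\<^sup>2) * (2 - \<eta>\<^sup>2)) * (1 - a)"
  proof (rule mult_right_mono)
    have "0 \<le> \<eta>\<^sup>2 * (1 - \<eta>\<^sup>2)" using \<eta>1 by simp
    then show "2 \<le> (1 + \<eta>\<^sup>2) * (2 - \<eta>\<^sup>2)" by (simp add: algebra_simps)
  qed (use a in auto)
  also have "\<dots> = (1 + \<eta>\<^sup>2) * ((2 - \<eta>\<^sup>2) * (1 - a))" by (simp add: mult.assoc)
  also have "\<dots> \<le> (1 + \<eta>\<^sup>2) * \<eta>\<^sup>2"
  proof (rule mult_left_mono)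
    have "(2 - \<eta>\<^sup>2) * (1 - a) \<le> (1 + a) * (1 - a)"
      using 1 \<open>a\<^sup>2 \<le> a\<close> a by (intro mult_right_mono) auto
    then show "(2 - \<eta>\<^sup>2) * (1 - a) \<le> \<eta>\<^sup>2" using 1 by (simp add: algebra_simps power2_eq_square)
  qed simp
  also have "\<dots> \<le> (1 + \<eta>)\<^sup>2 * \<eta>\<^sup>2" using \<eta>0 by (intro mult_right_mono) (auto simp: power2_sum)
  finally have "2 * (1 - a) \<le> (\<eta> * (1 + \<eta>))\<^sup>2" by (simp add: power_mult_distrib mult.commute)
  moreover have "(norm (e - v))\<^sup>2 = 2 * (1 - a)"
    unfolding power2_norm_eq_inner using ev by (simp add: inner_simps inner_commute a_def)
  ultimately have "(norm (e - v))\<^sup>2 \<le> (\<eta> * (1 + \<eta>))\<^sup>2" by simp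
  then show ?thesis by (rule power2_le_imp_le) (use \<eta>0 in auto)
qed

text \<open>Used for local estimates that hold only up to a factor \<open>m > 1\<close>: letting
  \<open>m\<close> tend to 1 recovers the sharp constant.\<close>

lemma lipschitz_on_of_larger_constants:
  fixes f :: "'a::metric_space \<Rightarrow> 'b::metric_space"
  assumes lip: "\<And>m. m > 1 \<Longrightarrow> (L * m)-lipschitz_on S f" and "L \<ge> 0"
  shows "L-lipschitz_on S f"
proof (rule lipschitz_onI)
  fix x y assume xy: "x \<in> S" "y \<in> S"
  show "dist (f x) (f y) \<le> L * dist x y"
  proof (rule field_le_mult_one_interval)
    fix z :: real assume z: "0 < z" "z < 1"
    have "dist (f x) (f y) \<le> L * (1 / z) * dist x y"
      using z by (intro lipschitz_onD[OF lip] xy) auto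
    also have "\<dots> = (L * dist x y) / z" by simp
    finally show "z * dist (f x) (f y) \<le> L * dist x y"
      using z by (simp only: pos_le_divide_eq mult.commute[of z])
  qed
qed fact

section \<open>The tangent field of an arc with differentiable distance function\<close>

context
  fixes \<gamma> :: "real \<Rightarrow> 'a::{real_inner,complete_space}" and l R :: real
  assumes l: "0 < l" and R: "R > 0"
    and nat: "natural_parametrization \<gamma> l" and cont: "continuous_on {0..l} \<gamma>" and inj: "inj_on \<gamma> {0..l}"
    and diff: "\<And>x. 0 < infdist x (\<gamma> ` {0..l}) \<Longrightarrow> infdist x (\<gamma> ` {0..l}) < R \<Longrightarrow>
      (\<lambda>y. infdist y (\<gamma> ` {0..l})) differentiable (at x)"
begin

lemma chord_le_arc:
  assumes "x \<in> {0..l}" "y \<in> {0..l}"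
  shows "norm (\<gamma> x - \<gamma> y) \<le> \<bar>x - y\<bar>"
  using natural_dist_le[OF nat, of x y] natural_dist_le[OF nat, of y x] assms
  by (cases "x \<le> y") (auto simp: dist_norm norm_minus_commute)

text \<open>Bounding the chord by the arc length \<open>\<delta>\<close> inside
  \<open>arc_le_of_chord\<close> shows that the chord is at least \<open>\<delta> * (1 - z)\<close>
  with \<open>z = \<delta>\<^sup>2 / (4 * R\<^sup>2)\<close>; square this and use
  \<open>(1 - z)\<^sup>2 \<ge> 1 - 2 * z\<close>.\<close>

lemma chord_sq_ge:
  assumes xy: "x \<in> {0..l}" "y \<in> {0..l}" "\<bar>x - y\<bar> \<le> R"
  shows "(x - y)\<^sup>2 - 1 / (2 * R\<^sup>2) * (x - y)^4 \<le> (norm (\<gamma> x - \<gamma> y))\<^sup>2"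
proof -
  have main: "(x - y)\<^sup>2 - 1 / (2 * R\<^sup>2) * (x - y)^4 \<le> (norm (\<gamma> x - \<gamma> y))\<^sup>2"
    if "x \<in> {0..l}" "y \<in> {0..l}" "x \<le> y" "y - x \<le> R" for x y
  proof -
    define c \<delta> z where "c = dist (\<gamma> x) (\<gamma> y)" and "\<delta> = y - x" and "z = (y - x)\<^sup>2 / (4 * R\<^sup>2)"
    have c: "0 \<le> c" "c \<le> \<delta>" using natural_dist_le[OF nat, of x y] that by (auto simp: c_def \<delta>_def)
    have \<delta>: "0 \<le> \<delta>" "\<delta> \<le> R" using that by (auto simp: \<delta>_def)
    have "\<delta> * (1 - c\<^sup>2 / (4 * R\<^sup>2)) \<le> c"
      unfolding c_def \<delta>_def using that c \<delta> R
      by (intro arc_le_of_chord[OF nat cont inj R diff]) (auto simp: c_def)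
    moreover have "c\<^sup>2 / (4 * R\<^sup>2) \<le> z"
      unfolding z_def using c by (intro divide_right_mono power_mono) (auto simp: \<delta>_def)
    then have "\<delta> * (1 - z) \<le> \<delta> * (1 - c\<^sup>2 / (4 * R\<^sup>2))" using \<delta> by (intro mult_left_mono) auto
    ultimately have "\<delta> * (1 - z) \<le> c" by simp
    moreover have "z \<le> 1"
    proof -
      have "\<delta>\<^sup>2 \<le> R\<^sup>2" using \<delta> by (intro power_mono) auto
      also have "\<dots> \<le> 4 * R\<^sup>2" by simp
      finally show ?thesis using R by (simp add: z_def \<delta>_def divide_le_eq)
    qed
    ultimately have "(\<delta> * (1 - z))\<^sup>2 \<le> c\<^sup>2" using \<delta> by (intro power_mono) auto
    moreover have "\<delta>\<^sup>2 * (1 - 2 * z) \<le> (\<delta> * (1 - z))\<^sup>2"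
    proof -
      have "\<delta>\<^sup>2 * (1 - 2 * z) \<le> \<delta>\<^sup>2 * (1 - z)\<^sup>2"
        by (intro mult_left_mono) (auto simp: power2_diff)
      then show ?thesis by (simp add: power_mult_distrib)
    qed
    moreover have "\<delta>\<^sup>2 * (1 - 2 * z) = (x - y)\<^sup>2 - 1 / (2 * R\<^sup>2) * (x - y)^4"
    proof -
      have "(x - y)\<^sup>2 = \<delta>\<^sup>2" "(x - y)^4 = \<delta>^4" by (simp_all add: \<delta>_def power2_commute power4_eq_xxxx power2_eq_square algebra_simps)
      then show ?thesis using R by (simp add: z_def \<delta>_def[symmetric] power2_eq_square power4_eq_xxxx field_simps)
    qed
    ultimately show ?thesis by (simp add: c_def dist_norm)
  qed
  show ?thesis
  proof (cases "x \<le> y")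
    case True
    then show ?thesis using main[of x y] xy by auto
  next
    case False
    have "(x - y)\<^sup>2 = (y - x)\<^sup>2" "(x - y)^4 = (y - x)^4"
      by (simp_all add: power2_commute power4_eq_xxxx algebra_simps)
    then show ?thesis using main[of y x] xy False by (simp add: norm_minus_commute)
  qed
qed

lemma tangent_field_exists:
  obtains u M where "M \<ge> 0" "\<And>s. s \<in> {0..l} \<Longrightarrow> norm (u s) = 1"
    "\<And>s q. s \<in> {0..l} \<Longrightarrow> q \<in> {0..l} \<Longrightarrow> 2 * \<bar>q - s\<bar> \<le> R \<Longrightarrow>
      norm (\<gamma> q - \<gamma> s - (q - s) *\<^sub>R u s) \<le> M * (q - s)\<^sup>2"
proof -
  define C where "C = 1 / (2 * R\<^sup>2)"
  have C: "C \<ge> 0" by (simp add: C_def)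
  have "\<exists>u. norm u = 1 \<and> (\<forall>q\<in>{0..l}. 2 * \<bar>q - s\<bar> \<le> R \<longrightarrow>
      norm (\<gamma> q - \<gamma> s - (q - s) *\<^sub>R u) \<le> 8 * sqrt C * (q - s)\<^sup>2)" if s: "s \<in> {0..l}" for s
    by (rule tangent_exists[OF l C R chord_le_arc chord_sq_ge[folded C_def] s]) (assumption | rule exI conjI ballI impI | blast)+
  then obtain u where "\<And>s. s \<in> {0..l} \<Longrightarrow> norm (u s) = 1 \<and> (\<forall>q\<in>{0..l}. 2 * \<bar>q - s\<bar> \<le> R \<longrightarrow>
      norm (\<gamma> q - \<gamma> s - (q - s) *\<^sub>R u s) \<le> 8 * sqrt C * (q - s)\<^sup>2)" by metis
  then show thesis using C by (intro that[of "8 * sqrt C" u]) auto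
qed

context
  fixes u :: "real \<Rightarrow> 'a" and M :: real
  assumes M: "M \<ge> 0" and u: "\<And>s. s \<in> {0..l} \<Longrightarrow> norm (u s) = 1"
    and tangent: "\<And>s q. s \<in> {0..l} \<Longrightarrow> q \<in> {0..l} \<Longrightarrow> 2 * \<bar>q - s\<bar> \<le> R \<Longrightarrow>
      norm (\<gamma> q - \<gamma> s - (q - s) *\<^sub>R u s) \<le> M * (q - s)\<^sup>2"
begin

text \<open>A touching ball of some small radius. At parameter distance \<open>h\<close> near
  \<open>s\<close> the tangent expansion bounds the normal component by \<open>M * h\<^sup>2\<close>
  and the chord from below by \<open>h / 2\<close>; away from \<open>s\<close>, injectivity and
  compactness keep the chord above some \<open>\<mu>\<close>.\<close>

lemma normal_component_quadratic:
  assumes s: "s \<in> {0..l}" and n: "norm n = 1" "n \<bullet> u s = 0"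
  obtains A where "A > 0" "\<And>t. t \<in> {0..l} \<Longrightarrow> n \<bullet> (\<gamma> t - \<gamma> s) \<le> A * (norm (\<gamma> t - \<gamma> s))\<^sup>2"
proof -
  define \<epsilon> where "\<epsilon> = min (R / 2) (1 / (2 * M + 1))"
  have \<epsilon>: "\<epsilon> > 0" using R M by (simp add: \<epsilon>_def)
  have M\<epsilon>: "M * \<epsilon> \<le> 1 / 2"
  proof -
    have "\<epsilon> \<le> 1 / (2 * M + 1)" by (simp add: \<epsilon>_def)
    then have "M * \<epsilon> \<le> M * (1 / (2 * M + 1))" using M by (intro mult_left_mono)
    also have "\<dots> \<le> 1 / 2" using M by (simp add: field_simps)
    finally show ?thesis .
  qed
  define F where "F = {0..l} - ball s \<epsilon>"
  obtain \<mu> where \<mu>: "\<mu> > 0" "\<And>t. t \<in> F \<Longrightarrow> \<mu> \<le> norm (\<gamma> t - \<gamma> s)"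
  proof (cases "F = {}")
    case True
    then show thesis using that[of 1] by simp
  next
    case False
    have "compact F" unfolding F_def by (intro compact_diff) auto
    moreover have "continuous_on F (\<lambda>t. norm (\<gamma> t - \<gamma> s))"
      by (intro continuous_intros continuous_on_subset[OF cont]) (auto simp: F_def)
    ultimately obtain t0 where t0: "t0 \<in> F" "\<And>t. t \<in> F \<Longrightarrow> norm (\<gamma> t0 - \<gamma> s) \<le> norm (\<gamma> t - \<gamma> s)"
      using continuous_attains_inf[of F] False by blast
    have "\<gamma> t0 \<noteq> \<gamma> s"
      using t0(1) s \<epsilon> inj_onD[OF inj, of t0 s] by (auto simp: F_def)
    then show thesis using that[of "norm (\<gamma> t0 - \<gamma> s)"] t0 by simp
  qed
  define A where "A = max (4 * M) (1 / \<mu>)"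
  show thesis
  proof (rule that)
    show "A > 0" using \<mu> by (simp add: A_def less_max_iff_disj)
    fix t assume t: "t \<in> {0..l}"
    define w where "w = \<gamma> t - \<gamma> s"
    show "n \<bullet> (\<gamma> t - \<gamma> s) \<le> A * (norm (\<gamma> t - \<gamma> s))\<^sup>2"
    proof (cases "t \<in> F")
      case True
      have "n \<bullet> w \<le> norm w" using norm_cauchy_schwarz[of n w] n by simp
      also have "norm w * \<mu> \<le> norm w * norm w" using \<mu>(2)[OF True] by (simp add: w_def mult_left_mono)
      then have "norm w \<le> 1 / \<mu> * (norm w)\<^sup>2" using \<mu> by (simp add: field_simps power2_eq_square)
      also have "\<dots> \<le> A * (norm w)\<^sup>2" by (intro mult_right_mono) (auto simp: A_def)
      finally show ?thesis by (simp add: w_def)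
    next
      case False
      define h where "h = \<bar>t - s\<bar>"
      have "h < \<epsilon>" using False t by (auto simp: F_def h_def dist_real_def abs_minus_commute)
      then have h: "0 \<le> h" "h \<le> \<epsilon>" "2 * h \<le> R" by (auto simp: h_def \<epsilon>_def)
      have hh: "(t - s)\<^sup>2 = h * h" by (simp add: h_def power2_eq_square)
      have dev: "norm (w - (t - s) *\<^sub>R u s) \<le> M * (h * h)"
        using tangent[OF s t] h by (simp add: w_def h_def hh[unfolded h_def])
      have "n \<bullet> w = n \<bullet> (w - (t - s) *\<^sub>R u s)" using n by (simp add: inner_simps)
      also have "\<dots> \<le> M * (h * h)" using norm_cauchy_schwarz[of n "w - (t - s) *\<^sub>R u s"] n dev by simp
      finally have 1: "n \<bullet> w \<le> M * (h * h)" .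
      have "h = norm ((t - s) *\<^sub>R u s)" using u[OF s] by (simp add: h_def)
      also have "\<dots> \<le> norm w + M * (h * h)"
        using dev norm_triangle_ineq4[of w "w - (t - s) *\<^sub>R u s"] by simp
      also have "M * h \<le> 1 / 2" using M\<epsilon> h M by (meson mult_left_mono order_trans)
      then have "M * (h * h) \<le> 1 / 2 * h" using h by (simp only: mult.assoc[symmetric] mult_right_mono)
      finally have "h \<le> 2 * norm w" by simp
      then have "h * h \<le> (2 * norm w) * (2 * norm w)" using h by (intro mult_mono) auto
      then have "M * (h * h) \<le> M * (4 * (norm w)\<^sup>2)" using M by (intro mult_left_mono) (auto simp: power2_eq_square)
      also have "\<dots> \<le> A * (norm w)\<^sup>2"
        using mult_right_mono[of "4 * M" A "(norm w)\<^sup>2"] by (simp add: A_def)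
      finally show ?thesis using 1 by (simp add: w_def)
    qed
  qed
qed

text \<open>Because of the crude constant \<open>A\<close>, the point reached by a short step
  \<open>r\<close> along \<open>n\<close> has \<open>\<gamma> s\<close> as a nearest point;
  \<open>proximal_normal_inequality\<close> then raises the radius of the touching ball to
  \<open>R\<close>.\<close>

lemma normal_is_proximal:
  assumes s: "s \<in> {0..l}" and n: "norm n = 1" "n \<bullet> u s = 0" and t: "t \<in> {0..l}"
  shows "n \<bullet> (\<gamma> t - \<gamma> s) \<le> (norm (\<gamma> t - \<gamma> s))\<^sup>2 / (2 * R)"
proof -
  obtain A where A: "A > 0" "\<And>t. t \<in> {0..l} \<Longrightarrow> n \<bullet> (\<gamma> t - \<gamma> s) \<le> A * (norm (\<gamma> t - \<gamma> s))\<^sup>2"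
    by (rule normal_component_quadratic[OF s n]) (rule that)
  define r where "r = min (R / 2) (1 / (2 * A))"
  have r: "0 < r" "r < R" using A R by (auto simp: r_def)
  have rA: "2 * r * A \<le> 1"
  proof -
    have "r \<le> 1 / (2 * A)" by (simp add: r_def)
    then show ?thesis using A by (simp add: field_simps)
  qed
  define x where "x = \<gamma> s + r *\<^sub>R n"
  define K where "K = \<gamma> ` {0..l}"
  have K: "compact K" "K \<noteq> {}" using cont l by (auto simp: K_def intro: compact_continuous_image)
  have far: "r \<le> dist x q" if "q \<in> K" for q
  proof -
    obtain \<tau> where \<tau>: "\<tau> \<in> {0..l}" "q = \<gamma> \<tau>" using \<open>q \<in> K\<close> by (auto simp: K_def)
    define w where "w = \<gamma> \<tau> - \<gamma> s"
    have "2 * r * (n \<bullet> w) \<le> 2 * r * (A * (norm w)\<^sup>2)"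
      using A(2)[OF \<tau>(1)] r by (intro mult_left_mono) (auto simp: w_def)
    also have "\<dots> \<le> 1 * (norm w)\<^sup>2"
      using mult_right_mono[OF rA, of "(norm w)\<^sup>2"] by (simp add: mult.assoc)
    finally have "r\<^sup>2 \<le> (norm (r *\<^sub>R n - w))\<^sup>2" using n by (simp add: norm_scaleR_diff_sq)
    then have "r \<le> norm (r *\<^sub>R n - w)" by (rule power2_le_imp_le) simp
    moreover have "x - q = r *\<^sub>R n - w" by (simp add: x_def \<tau> w_def)
    ultimately show ?thesis by (simp add: dist_norm)
  qed
  have "dist x (\<gamma> s) = r" using r n by (simp add: x_def dist_norm)
  moreover have "\<gamma> s \<in> K" using s by (simp add: K_def)
  ultimately have xr: "infdist x K = r"
    using far K infdist_le[of "\<gamma> s" K x]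
    by (intro order_antisym) (auto simp: infdist_notempty intro!: cINF_greatest)
  then have "nearest K x (\<gamma> s)" using \<open>dist x (\<gamma> s) = r\<close> \<open>\<gamma> s \<in> K\<close> by (simp add: nearest_def)
  from proximal_normal_inequality[OF K R diff[folded K_def] _ this, of "\<gamma> t"]
  have *: "r * (n \<bullet> (\<gamma> t - \<gamma> s)) \<le> r * ((norm (\<gamma> t - \<gamma> s))\<^sup>2 / (2 * R))"
    using xr r t by (simp add: x_def K_def)
  show ?thesis by (rule mult_left_le_imp_le[OF * r(1)])
qed

text \<open>Apply \<open>normal_is_proximal\<close> to the normalised component of \<open>w\<close>
  orthogonal to the tangent. On a circle of radius \<open>R\<close> equality holds.\<close>

lemma chord_deviation:
  assumes s: "s \<in> {0..l}" and t: "t \<in> {0..l}"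
  defines "w \<equiv> \<gamma> t - \<gamma> s"
  shows "norm (w - (w \<bullet> u s) *\<^sub>R u s) \<le> (norm w)\<^sup>2 / (2 * R)"
proof (cases "w - (w \<bullet> u s) *\<^sub>R u s = 0")
  case False
  define z where "z = w - (w \<bullet> u s) *\<^sub>R u s"
  define n where "n = (1 / norm z) *\<^sub>R z"
  have uu: "u s \<bullet> u s = 1" using u[OF s] by (simp add: dot_square_norm)
  have z0: "norm z > 0" using False by (simp add: z_def)
  have zu: "z \<bullet> u s = 0" by (simp add: z_def inner_simps uu)
  have "norm n = 1" "n \<bullet> u s = 0" using z0 zu by (simp_all add: n_def)
  from normal_is_proximal[OF s this t] have "n \<bullet> w \<le> (norm w)\<^sup>2 / (2 * R)" by (simp add: w_def)
  moreover have "z \<bullet> w = (norm z)\<^sup>2"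
  proof -
    have "z \<bullet> w = z \<bullet> (z + (w \<bullet> u s) *\<^sub>R u s)" by (simp add: z_def)
    also have "\<dots> = (norm z)\<^sup>2" by (simp add: inner_add_right zu power2_norm_eq_inner)
    finally show ?thesis .
  qed
  then have "n \<bullet> w = norm z" using z0 by (simp add: n_def power2_eq_square)
  ultimately show ?thesis by (simp add: z_def)
qed (use R in simp)

text \<open>The chord direction \<open>e\<close> makes with both end tangents an angle of sine at
  most \<open>\<eta> = norm w / (2 * R)\<close>, so it lies within
  \<open>\<eta> * (1 + \<eta>)\<close> of each. Twice this is, to leading order, at most
  \<open>(t - s) / R\<close>.\<close>

lemma tangent_field_estimate:
  assumes st: "s \<in> {0..l}" "t \<in> {0..l}" "s < t" and small: "2 * (t - s) \<le> R" "M * (t - s) < 1"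
  shows "norm (u s - u t) \<le> (t - s) / R * (1 + (t - s) / (2 * R))"
proof -
  define w \<delta> where "w = \<gamma> t - \<gamma> s" and "\<delta> = t - s"
  have \<delta>: "\<delta> > 0" "\<delta> \<le> R" using st small R by (auto simp: \<delta>_def)
  have w\<delta>: "norm w \<le> \<delta>" using chord_le_arc[of t s] st by (simp add: w_def \<delta>_def)
  have less: "M * \<delta>\<^sup>2 < \<delta>" using small \<delta> mult_strict_right_mono[of "M * \<delta>" 1 \<delta>]
    by (simp add: \<delta>_def power2_eq_square mult.assoc)
  \<comment> \<open>The deviation only sees the line spanned by the tangent; positivity of
    \<open>w \<bullet> v\<close> excludes that the chord points backwards.\<close>
  have pos: "w \<bullet> v > 0" if v: "norm v = 1" and dev: "norm (w - \<delta> *\<^sub>R v) \<le> M * \<delta>\<^sup>2" for v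
  proof -
    have "\<delta> - w \<bullet> v = (\<delta> *\<^sub>R v - w) \<bullet> v" using v by (simp add: inner_simps dot_square_norm)
    also have "\<dots> \<le> norm (w - \<delta> *\<^sub>R v)" using norm_cauchy_schwarz[of "\<delta> *\<^sub>R v - w" v] v by (simp add: norm_minus_commute)
    finally show ?thesis using dev less by simp
  qed
  have ps: "w \<bullet> u s > 0"
    using tangent[OF st(1,2)] small st by (intro pos u) (auto simp: w_def \<delta>_def)
  have pt: "w \<bullet> u t > 0"
  proof (intro pos u st)
    have "norm (w - \<delta> *\<^sub>R u t) = norm (\<gamma> s - \<gamma> t - (s - t) *\<^sub>R u t)"
    proof -
      have "w - \<delta> *\<^sub>R u t = - (\<gamma> s - \<gamma> t - (s - t) *\<^sub>R u t)"
        by (simp add: w_def \<delta>_def algebra_simps)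
      then show ?thesis by (simp only: norm_minus_cancel)
    qed
    then show "norm (w - \<delta> *\<^sub>R u t) \<le> M * \<delta>\<^sup>2"
      using tangent[OF st(2,1)] small st by (simp add: \<delta>_def power2_commute)
  qed
  have w0: "norm w > 0" using ps by auto
  define e \<eta> where "e = (1 / norm w) *\<^sub>R w" and "\<eta> = norm w / (2 * R)"
  have \<eta>: "0 \<le> \<eta>" "\<eta> \<le> \<delta> / (2 * R)" "\<eta> \<le> 1"
    using w\<delta> \<delta> R by (auto simp: \<eta>_def divide_right_mono divide_le_eq)
  have close: "norm (e - v) \<le> \<eta> * (1 + \<eta>)"
    if v: "norm v = 1" and p: "w \<bullet> v > 0" and dev: "norm (w - (w \<bullet> v) *\<^sub>R v) \<le> (norm w)\<^sup>2 / (2 * R)" for v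
  proof (rule norm_diff_le_of_deviation)
    have "e - (e \<bullet> v) *\<^sub>R v = (1 / norm w) *\<^sub>R (w - (w \<bullet> v) *\<^sub>R v)"
      by (simp add: e_def scaleR_diff_right)
    then have "norm (e - (e \<bullet> v) *\<^sub>R v) = norm (w - (w \<bullet> v) *\<^sub>R v) / norm w"
      by simp
    also have "\<dots> \<le> ((norm w)\<^sup>2 / (2 * R)) / norm w" using dev by (intro divide_right_mono) auto
    also have "\<dots> = \<eta>" using w0 by (simp add: \<eta>_def power2_eq_square)
    finally show "norm (e - (e \<bullet> v) *\<^sub>R v) \<le> \<eta>" .
  qed (use w0 v p \<eta> in \<open>auto simp: e_def\<close>)
  have "norm (e - u s) \<le> \<eta> * (1 + \<eta>)"
    using chord_deviation[OF st(1,2)] by (intro close u ps st) (simp add: w_def)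
  moreover have "norm (e - u t) \<le> \<eta> * (1 + \<eta>)"
  proof (intro close u pt st)
    have "norm (\<gamma> s - \<gamma> t - ((\<gamma> s - \<gamma> t) \<bullet> u t) *\<^sub>R u t) \<le> (norm (\<gamma> s - \<gamma> t))\<^sup>2 / (2 * R)"
      by (rule chord_deviation[OF st(2,1)])
    moreover have "\<gamma> s - \<gamma> t = - w" by (simp add: w_def)
    ultimately show "norm (w - (w \<bullet> u t) *\<^sub>R u t) \<le> (norm w)\<^sup>2 / (2 * R)"
      by (simp add: norm_minus_commute)
  qed
  ultimately have "norm (u s - u t) \<le> 2 * (\<eta> * (1 + \<eta>))"
    using norm_triangle_ineq4[of "e - u t" "e - u s"] by simp
  also have "\<dots> \<le> 2 * (\<delta> / (2 * R) * (1 + \<delta> / (2 * R)))"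
    using \<eta> by (intro mult_left_mono mult_mono) auto
  finally show ?thesis by (simp add: \<delta>_def)
qed

text \<open>Continuity is the prerequisite for passing from local estimates to a global Lipschitz
  constant; the crude local constant \<open>2 / R\<close> is enough for it.\<close>

lemma tangent_field_continuous: "continuous_on {0..l} u"
proof -
  define \<epsilon> where "\<epsilon> = min (R / 2) (1 / (2 * M + 1))"
  have \<epsilon>: "\<epsilon> > 0" using R M by (simp add: \<epsilon>_def)
  have M\<epsilon>: "M * h < 1" if "h \<le> \<epsilon>" "0 \<le> h" for h
  proof -
    have "M * h \<le> M * (1 / (2 * M + 1))" using that M by (intro mult_left_mono) (auto simp: \<epsilon>_def)
    also have "\<dots> < 1" using M by (simp add: field_simps)
    finally show ?thesis .
  qed
  have est: "norm (u s - u t) \<le> 2 / R * (t - s)"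
    if "s \<in> {0..l}" "t \<in> {0..l}" "s < t" "t - s \<le> \<epsilon>" for s t
  proof -
    have "norm (u s - u t) \<le> (t - s) / R * (1 + (t - s) / (2 * R))"
      using that M\<epsilon>[of "t - s"] by (intro tangent_field_estimate) (auto simp: \<epsilon>_def)
    also have "\<dots> \<le> (t - s) / R * 2"
      using that R by (intro mult_left_mono) (auto simp: \<epsilon>_def divide_le_eq)
    finally show ?thesis by (simp add: mult.commute)
  qed
  show ?thesis
  proof (rule continuous_on_iff[THEN iffD2], intro ballI allI impI)
    fix s e :: real assume s: "s \<in> {0..l}" and e: "e > 0"
    define d where "d = min \<epsilon> (e * R / 2)"
    have "dist (u t) (u s) < e" if t: "t \<in> {0..l}" and ts: "dist t s < d" for t
    proof -
      have "\<bar>t - s\<bar> < e * R / 2" "\<bar>t - s\<bar> \<le> \<epsilon>" using ts by (auto simp: d_def dist_real_def)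
      then have "2 / R * \<bar>t - s\<bar> < e" using R by (simp add: field_simps)
      moreover have "dist (u t) (u s) \<le> 2 / R * \<bar>t - s\<bar>"
        using est[of s t] est[of t s] s t \<open>\<bar>t - s\<bar> \<le> \<epsilon>\<close>
        by (cases s t rule: linorder_cases) (auto simp: dist_norm norm_minus_commute)
      ultimately show ?thesis by simp
    qed
    moreover have "d > 0" using \<epsilon> e R by (simp add: d_def)
    ultimately show "\<exists>d>0. \<forall>t\<in>{0..l}. dist t s < d \<longrightarrow> dist (u t) (u s) < e" by blast
  qed
qed

text \<open>By \<open>tangent_field_estimate\<close> short steps to the right satisfy the bound with
  constant \<open>m / R\<close> for any \<open>m > 1\<close>. By continuity this holds globally, and
  \<open>m\<close> tends to 1.\<close>

lemma tangent_field_lipschitz: "(1 / R)-lipschitz_on {0..l} u"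
proof -
  have lip: "((1 / R) * m)-lipschitz_on {0..l} u" if m: "m > 1" for m
  proof (rule locally_lipschitz_imp_lipschitz[OF tangent_field_continuous])
    fix s y assume s: "s \<in> {0..<l}" and y: "y > s"
    \<comment> \<open>The bounds keep \<open>s + \<delta>\<close> in \<open>{s<..y}\<close> and in
      the domain, meet the smallness conditions of \<open>tangent_field_estimate\<close>, and make
      \<open>1 + \<delta> / (2 * R) \<le> m\<close>.\<close>
    define \<delta> where "\<delta> = Min {y - s, l - s, R / 2, 1 / (2 * M + 1), 2 * R * (m - 1)}"
    have \<delta>: "\<delta> > 0" using s y R M m by (simp add: \<delta>_def)
    have \<delta>': "\<delta> \<le> y - s" "\<delta> \<le> l - s" "\<delta> \<le> R / 2" "\<delta> \<le> 1 / (2 * M + 1)" "\<delta> \<le> 2 * R * (m - 1)"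
    proof -
      have "\<forall>z\<in>{y - s, l - s, R / 2, 1 / (2 * M + 1), 2 * R * (m - 1)}. \<delta> \<le> z"
        unfolding \<delta>_def by (intro ballI Min_le) auto
      then show "\<delta> \<le> y - s" "\<delta> \<le> l - s" "\<delta> \<le> R / 2" "\<delta> \<le> 1 / (2 * M + 1)" "\<delta> \<le> 2 * R * (m - 1)"
        by blast+
    qed
    have "M * \<delta> \<le> M * (1 / (2 * M + 1))" using \<delta>' M by (intro mult_left_mono) auto
    also have "\<dots> < 1" using M by (simp add: field_simps)
    finally have "norm (u s - u (s + \<delta>)) \<le> \<delta> / R * (1 + \<delta> / (2 * R))"
      using tangent_field_estimate[of s "s + \<delta>"] s \<delta> \<delta>' by simp
    also have "\<dots> \<le> \<delta> / R * m"
      using \<delta> \<delta>' R by (intro mult_left_mono) (auto simp: field_simps)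
    finally show "\<exists>z\<in>{s<..y}. dist (u z) (u s) \<le> 1 / R * m * (z - s)"
      using \<delta> \<delta>' by (intro bexI[of _ "s + \<delta>"]) (auto simp: dist_norm norm_minus_commute mult.commute)
  qed (use R m in auto)
  show ?thesis by (rule lipschitz_on_of_larger_constants[OF lip]) (use R in auto)
qed

lemma tangent_field_is_derivative:
  assumes s: "s \<in> {0..l}"
  shows "(\<gamma> has_vector_derivative u s) (at s within {0..l})"
proof -
  have "((\<lambda>q. (1 / \<bar>q - s\<bar>) *\<^sub>R (\<gamma> q - (\<gamma> s + (q - s) *\<^sub>R u s))) \<longlongrightarrow> 0) (at s within {0..l})"
  proof (rule Lim_null_comparison)
    have "\<forall>\<^sub>F q in at s within {0..l}. q \<in> {0..l} \<and> q \<noteq> s \<and> dist q s < R / 2"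
      unfolding eventually_at using R by (intro exI[of _ "R / 2"]) auto
    then show "\<forall>\<^sub>F q in at s within {0..l}.
        norm ((1 / \<bar>q - s\<bar>) *\<^sub>R (\<gamma> q - (\<gamma> s + (q - s) *\<^sub>R u s))) \<le> M * \<bar>q - s\<bar>"
    proof (rule eventually_mono)
      fix q assume q: "q \<in> {0..l} \<and> q \<noteq> s \<and> dist q s < R / 2"
      then have "norm (\<gamma> q - \<gamma> s - (q - s) *\<^sub>R u s) \<le> M * (q - s)\<^sup>2"
        using s by (intro tangent) (auto simp: dist_real_def)
      also have "(q - s)\<^sup>2 = \<bar>q - s\<bar> * \<bar>q - s\<bar>" by (simp add: power2_eq_square)
      finally show "norm ((1 / \<bar>q - s\<bar>) *\<^sub>R (\<gamma> q - (\<gamma> s + (q - s) *\<^sub>R u s))) \<le> M * \<bar>q - s\<bar>"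
        using q by (simp add: divide_le_eq diff_diff_eq mult.assoc)
    qed
    have "((\<lambda>q. M * \<bar>q - s\<bar>) \<longlongrightarrow> M * \<bar>s - s\<bar>) (at s within {0..l})"
      by (intro tendsto_intros)
    then show "((\<lambda>q. M * \<bar>q - s\<bar>) \<longlongrightarrow> 0) (at s within {0..l})" by simp
  qed
  then show ?thesis
    by (simp add: has_vector_derivative_def has_derivative_within bounded_linear_scaleR_left inverse_eq_divide)
qed

end

lemma natural_parametrization_C11:
  "(\<forall>t\<in>{0..l}. \<gamma> differentiable (at t within {0..l})) \<and>
    (1 / R)-lipschitz_on {0..l} (\<lambda>t. vector_derivative \<gamma> (at t within {0..l}))"
proof -
  obtain u M where uM: "M \<ge> 0" "\<And>s. s \<in> {0..l} \<Longrightarrow> norm (u s) = 1"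
    "\<And>s q. s \<in> {0..l} \<Longrightarrow> q \<in> {0..l} \<Longrightarrow> 2 * \<bar>q - s\<bar> \<le> R \<Longrightarrow>
      norm (\<gamma> q - \<gamma> s - (q - s) *\<^sub>R u s) \<le> M * (q - s)\<^sup>2"
    by (rule tangent_field_exists) (rule that)
  have deriv: "(\<gamma> has_vector_derivative u s) (at s within {0..l})" if "s \<in> {0..l}" for s
    using tangent_field_is_derivative[OF uM that] .
  have "vector_derivative \<gamma> (at s within {0..l}) = u s" if "s \<in> {0..l}" for s
    using vector_derivative_within_cbox[of 0 l s \<gamma> "u s"] l deriv[OF that] that by auto
  then have "(1 / R)-lipschitz_on {0..l} (\<lambda>t. vector_derivative \<gamma> (at t within {0..l}))"
    using tangent_field_lipschitz[OF uM] by (simp add: lipschitz_on_def)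
  moreover have "\<gamma> differentiable (at s within {0..l})" if "s \<in> {0..l}" for s
    using deriv[OF that] by (auto intro: differentiableI_vector)
  ultimately show ?thesis by blast
qed

end

section \<open>Comparison with circles\<close>

text \<open>Split \<open>a\<close> and \<open>c\<close> into parts along \<open>b\<close> and
  orthogonal to \<open>b\<close>. The orthogonal parts have norms \<open>sin A\<close> and
  \<open>sin B\<close>, so Cauchy-Schwarz gives \<open>cos (A + B) \<le> a \<bullet> c\<close>. If
  \<open>A + B\<close> exceeds \<open>pi\<close>, the bound is trivial.\<close>

lemma arccos_inner_triangle:
  fixes a b c :: "'a::real_inner"
  assumes "norm a = 1" "norm b = 1" "norm c = 1"
  shows "arccos (a \<bullet> c) \<le> arccos (a \<bullet> b) + arccos (b \<bullet> c)"
proof -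
  have bd: "\<bar>x \<bullet> y\<bar> \<le> 1" if "norm x = 1" "norm y = 1" for x y :: 'a
    using Cauchy_Schwarz_ineq2[of x y] that by simp
  define A B where "A = arccos (a \<bullet> b)" and "B = arccos (b \<bullet> c)"
  have ab: "\<bar>a \<bullet> b\<bar> \<le> 1" "\<bar>b \<bullet> c\<bar> \<le> 1" "\<bar>a \<bullet> c\<bar> \<le> 1" using assms bd by auto
  have AB: "0 \<le> A" "0 \<le> B" "cos A = a \<bullet> b" "cos B = b \<bullet> c"
    using ab by (auto simp: A_def B_def arccos_lbound cos_arccos_abs abs_le_iff)
  show ?thesis
  proof (cases "A + B \<le> pi")
    case True
    define a' c' where "a' = a - (a \<bullet> b) *\<^sub>R b" and "c' = c - (b \<bullet> c) *\<^sub>R b"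
    have one: "a \<bullet> a = 1" "b \<bullet> b = 1" "c \<bullet> c = 1" using assms by (simp_all add: dot_square_norm)
    have "(norm a')\<^sup>2 = 1 - (a \<bullet> b)\<^sup>2" "(norm c')\<^sup>2 = 1 - (b \<bullet> c)\<^sup>2"
      unfolding power2_norm_eq_inner using one
      by (simp_all add: a'_def c'_def inner_simps inner_commute power2_eq_square)
    then have "norm a' = sqrt (1 - (a \<bullet> b)\<^sup>2)" "norm c' = sqrt (1 - (b \<bullet> c)\<^sup>2)"
      by (metis norm_ge_zero real_sqrt_abs abs_of_nonneg)+
    then have n: "norm a' = sin A" "norm c' = sin B"
      using ab by (simp_all add: A_def B_def sin_arccos_abs)
    have "cos (A + B) = (a \<bullet> b) * (b \<bullet> c) - norm a' * norm c'" by (simp add: cos_add AB n)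
    also have "\<dots> \<le> (a \<bullet> b) * (b \<bullet> c) + a' \<bullet> c'"
      using Cauchy_Schwarz_ineq2[of a' c'] by (simp add: abs_le_iff)
    also have "\<dots> = a \<bullet> c"
      using one by (simp add: a'_def c'_def inner_simps inner_commute algebra_simps)
    finally have "arccos (a \<bullet> c) \<le> arccos (cos (A + B))"
      using ab by (intro arccos_le_arccos) auto
    then show ?thesis using True AB by (simp add: arccos_cos) (simp add: A_def B_def)
  next
    case False
    then show ?thesis using arccos_ubound[of "a \<bullet> c"] ab by (auto simp: A_def B_def abs_le_iff)
  qed
qed

lemma arcsin_le_near_0:
  assumes "m > 1"
  obtains \<epsilon> where "\<epsilon> > 0" "\<And>y. 0 \<le> y \<Longrightarrow> y < \<epsilon> \<Longrightarrow> arcsin y \<le> m * y"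
proof -
  have "(arcsin has_real_derivative 1) (at 0)" using DERIV_arcsin[of 0] by simp
  then have "((\<lambda>h. arcsin h / h) \<longlongrightarrow> 1) (at 0)" by (simp add: DERIV_def)
  from order_tendstoD(2)[OF this assms] obtain \<epsilon> where
    "\<epsilon> > 0" "\<And>y. y \<noteq> 0 \<Longrightarrow> \<bar>y\<bar> < \<epsilon> \<Longrightarrow> arcsin y / y < m"
    by (auto simp: eventually_at dist_real_def)
  then have "arcsin y \<le> m * y" if "0 \<le> y" "y < \<epsilon>" for y
    using that by (cases "y = 0") (force simp: divide_less_eq)+
  with \<open>\<epsilon> > 0\<close> show thesis by (rule that)
qed

text \<open>A chord of the unit circle over the angle \<open>\<theta>\<close> has length
  \<open>2 * sin (\<theta> / 2)\<close>.\<close>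

lemma arccos_inner_eq_arcsin:
  fixes a b :: "'a::real_inner"
  assumes "norm a = 1" "norm b = 1"
  shows "arccos (a \<bullet> b) = 2 * arcsin (norm (a - b) / 2)"
proof -
  define d where "d = norm (a - b) / 2"
  have "norm (a - b) \<le> 2" using norm_triangle_ineq4[of a b] assms by simp
  then have d: "0 \<le> d" "d \<le> 1" by (auto simp: d_def)
  have "a \<bullet> a = 1" "b \<bullet> b = 1" using assms by (simp_all add: dot_square_norm)
  then have "(norm (a - b))\<^sup>2 = 2 - 2 * (a \<bullet> b)"
    unfolding power2_norm_eq_inner by (simp add: inner_simps inner_commute)
  then have "a \<bullet> b = 1 - 2 * d\<^sup>2" by (simp add: d_def power_divide field_simps)
  also have "\<dots> = cos (2 * arcsin d)" using d by (simp add: cos_double_sin)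
  finally have "a \<bullet> b = cos (2 * arcsin d)" .
  moreover have "0 \<le> arcsin d" using d arcsin_le_arcsin[of 0 d] by simp
  moreover have "2 * arcsin d \<le> pi" using d arcsin_bounded[of d] by simp
  ultimately show ?thesis by (simp add: arccos_cos d_def)
qed

text \<open>Uniqueness and compactness make the projection \<open>P\<close> continuous; then the
  squared distance has gradient \<open>2 *\<^sub>R (x - P x)\<close>, and off \<open>K\<close> the
  distance itself has the continuous gradient
  \<open>(1 / infdist x K) *\<^sub>R (x - P x)\<close>.\<close>

lemma proximally_smooth_of_unique_nearest:
  fixes K :: "'a::real_inner set"
  assumes K: "compact K" "K \<noteq> {}"
    and uniq: "\<And>x p q. infdist x K < R \<Longrightarrow> nearest K x p \<Longrightarrow> nearest K x q \<Longrightarrow> p = q"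
  shows "proximally_smooth R K"
proof -
  have "\<exists>p. nearest K x p" for x using nearest_exists[OF K] by metis
  then obtain P where P: "\<And>x. nearest K x (P x)" by metis
  have PK: "P x \<in> K" "norm (x - P x) = infdist x K" for x
    using P[of x] by (auto simp: nearest_def dist_norm)
  define U where "U = {x. 0 < infdist x K \<and> infdist x K < R}"
  have contP: "isCont P x" if x: "infdist x K < R" for x
    unfolding continuous_at_eps_delta
  proof (intro allI impI)
    fix e :: real assume e: "e > 0"
    define F where "F = K - ball (P x) e"
    have "compact F" unfolding F_def using K by (intro compact_diff) auto
    \<comment> \<open>Points of \<open>K\<close> at least \<open>e\<close> away from
      \<open>P x\<close> are farther from \<open>x\<close> than \<open>P x\<close> is, by a margin
      \<open>\<mu>\<close>; moving \<open>x\<close> by less than half the margin cannot make them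
      nearest.\<close>
    obtain \<mu> where \<mu>: "\<mu> > 0" "\<And>q. q \<in> F \<Longrightarrow> infdist x K + \<mu> \<le> dist x q"
    proof (cases "F = {}")
      case True
      then show thesis using that[of 1] by simp
    next
      case False
      obtain p where p: "nearest F x p" using nearest_exists[OF \<open>compact F\<close> False] .
      then have "p \<in> K" "p \<noteq> P x" using e by (auto simp: nearest_def F_def)
      then have "dist x p \<noteq> infdist x K" using uniq[OF x P[of x], of p] by (auto simp: nearest_def)
      then have "infdist x K < dist x p" using infdist_le[OF \<open>p \<in> K\<close>, of x] by simp
      moreover have "dist x p \<le> dist x q" if "q \<in> F" for q
        using p infdist_le[OF that, of x] by (simp add: nearest_def)
      ultimately show thesis by (intro that[of "dist x p - infdist x K"]) auto
    qed
    have "dist (P y) (P x) < e" if y: "dist y x < \<mu> / 2" for y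
    proof (rule ccontr)
      assume "\<not> dist (P y) (P x) < e"
      then have "P y \<in> F" using PK by (auto simp: F_def dist_commute)
      then have "infdist x K + \<mu> \<le> dist x (P y)" by (rule \<mu>)
      also have "\<dots> \<le> dist x y + infdist y K" using dist_triangle[of x "P y" y] P[of y] by (simp add: nearest_def)
      also have "infdist y K \<le> infdist x K + dist y x" by (rule infdist_triangle)
      finally show False using y by (simp add: dist_commute)
    qed
    then show "\<exists>d>0. \<forall>y. dist y x < d \<longrightarrow> dist (P y) (P x) < e"
      using \<mu>(1) half_gt_zero by blast
  qed
  have deriv_sq: "((\<lambda>y. (infdist y K)\<^sup>2) has_derivative (\<lambda>v. 2 * ((x - P x) \<bullet> v))) (at x)"
    if x: "infdist x K < R" for x
    unfolding has_derivative_within_alt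
  proof (intro conjI allI impI)
    show "bounded_linear (\<lambda>v. 2 * ((x - P x) \<bullet> v))"
      by (intro bounded_linear_const_mult bounded_linear_inner_right)
    fix e :: real assume e: "e > 0"
    then have "e / 3 > 0" by simp
    then obtain d where d: "d > 0" "\<And>y. dist y x < d \<Longrightarrow> dist (P y) (P x) < e / 3"
      using contP[OF x] unfolding continuous_at_eps_delta by blast
    have "norm ((infdist y K)\<^sup>2 - (infdist x K)\<^sup>2 - 2 * ((x - P x) \<bullet> (y - x))) \<le> e * norm (y - x)"
      if y: "norm (y - x) < min d (e / 3)" for y
    proof -
      define v where "v = y - x"
      have yx: "y = x + v" by (simp add: v_def)
      have le: "(infdist z K)\<^sup>2 \<le> (norm (z - q))\<^sup>2" if "q \<in> K" for z q
        using infdist_le[OF that, of z] infdist_nonneg[of z K] by (auto simp: dist_norm intro: power_mono)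
      \<comment> \<open>Testing the distance of \<open>y\<close> with \<open>P x\<close> gives the
        upper bound; testing the distance of \<open>x\<close> with \<open>P y\<close> gives the
        lower one, up to the displacement of the projection.\<close>
      have "(infdist y K)\<^sup>2 \<le> (norm (x - P x))\<^sup>2 + 2 * ((x - P x) \<bullet> v) + (norm v)\<^sup>2"
        using le[OF PK(1)[of x], of y] unfolding yx power2_norm_eq_inner
        by (simp add: inner_simps inner_commute)
      then have up: "(infdist y K)\<^sup>2 - (infdist x K)\<^sup>2 - 2 * ((x - P x) \<bullet> v) \<le> norm v * norm v"
        by (simp add: PK(2) power2_eq_square)
      have "(infdist x K)\<^sup>2 \<le> (norm (y - P y))\<^sup>2 - 2 * ((x - P x) \<bullet> v) + 2 * ((P y - P x) \<bullet> v) - (norm v)\<^sup>2"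
        using le[OF PK(1)[of y], of x] unfolding yx power2_norm_eq_inner
        by (simp add: inner_simps inner_commute)
      then have "(infdist y K)\<^sup>2 - (infdist x K)\<^sup>2 - 2 * ((x - P x) \<bullet> v) \<ge> norm v * norm v - 2 * ((P y - P x) \<bullet> v)"
        by (simp add: PK(2) power2_eq_square)
      moreover have "(P y - P x) \<bullet> v \<le> e / 3 * norm v"
      proof -
        have "norm (P y - P x) \<le> e / 3" using d(2)[of y] y by (simp add: dist_norm less_imp_le)
        then have "norm (P y - P x) * norm v \<le> e / 3 * norm v" by (intro mult_right_mono) auto
        then show ?thesis using norm_cauchy_schwarz[of "P y - P x" v] by linarith
      qed
      moreover have "norm v * norm v \<le> e / 3 * norm v"
        using y by (intro mult_right_mono) (auto simp: v_def)
      moreover have "0 \<le> e * norm v" "0 \<le> norm v * norm v" using e by auto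
      ultimately have "\<bar>(infdist y K)\<^sup>2 - (infdist x K)\<^sup>2 - 2 * ((x - P x) \<bullet> v)\<bar> \<le> e * norm v"
        using up by (simp only: abs_le_iff) linarith
      then show ?thesis by (simp add: v_def)
    qed
    then show "\<exists>d>0. \<forall>y\<in>UNIV. norm (y - x) < d \<longrightarrow>
        norm ((infdist y K)\<^sup>2 - (infdist x K)\<^sup>2 - 2 * ((x - P x) \<bullet> (y - x))) \<le> e * norm (y - x)"
      using d(1) \<open>e / 3 > 0\<close> by (intro exI[of _ "min d (e / 3)"]) auto
  qed
  define D where "D = (\<lambda>x. blinfun_inner_right ((1 / infdist x K) *\<^sub>R (x - P x)))"
  have "((\<lambda>y. infdist y K) has_derivative blinfun_apply (D x)) (at x)" if "x \<in> U" for x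
  proof -
    have x: "0 < infdist x K" "infdist x K < R" using that by (auto simp: U_def)
    have "((\<lambda>y. sqrt ((infdist y K)\<^sup>2)) has_derivative
        (\<lambda>v. 2 * ((x - P x) \<bullet> v) * (inverse (sqrt ((infdist x K)\<^sup>2)) / 2))) (at x)"
      by (rule has_derivative_eq_rhs[OF has_derivative_real_sqrt[OF _ deriv_sq[OF x(2)]]]) (use x in auto)
    moreover have "2 * ((x - P x) \<bullet> v) * (inverse (sqrt ((infdist x K)\<^sup>2)) / 2) = D x v" for v
    proof -
      have "D x v = 1 / infdist x K * ((x - P x) \<bullet> v)"
        by (simp only: D_def blinfun_inner_right.rep_eq inner_scaleR_left)
      moreover have "sqrt ((infdist x K)\<^sup>2) = infdist x K" using x by simp
      ultimately show ?thesis by (simp only: inverse_eq_divide) simp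
    qed
    moreover have "sqrt ((infdist y K)\<^sup>2) = infdist y K" for y by (simp add: infdist_nonneg)
    ultimately show ?thesis by (simp only:)
  qed
  moreover have "continuous_on U D"
  proof -
    have "continuous_on U P"
      using contP by (intro continuous_at_imp_continuous_on) (auto simp: U_def)
    then have "continuous_on U (\<lambda>x. (1 / infdist x K) *\<^sub>R (x - P x))"
      by (intro continuous_intros) (auto simp: U_def)
    then show ?thesis
      unfolding D_def by (rule bounded_linear.continuous_on[OF bounded_linear_blinfun_inner_right])
  qed
  ultimately show ?thesis
    using compact_imp_closed[OF K(1)]
    unfolding proximally_smooth_def continuously_differentiable_on_def U_def by blast
qed

section \<open>Arcs with \<open>(1 / R)\<close>-Lipschitz derivative and length at most
  \<open>pi * R\<close>\<close>

context
  fixes \<gamma> u :: "real \<Rightarrow> 'a::{real_inner,complete_space}" and l R :: real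
  assumes l: "0 < l" and R: "R > 0" and lR: "l \<le> pi * R"
    and nat: "natural_parametrization \<gamma> l" and inj: "inj_on \<gamma> {0..l}"
    and deriv: "\<And>t. t \<in> {0..l} \<Longrightarrow> (\<gamma> has_vector_derivative u t) (at t within {0..l})"
    and lip: "(1 / R)-lipschitz_on {0..l} u"
begin

lemma derivative_lipschitz:
  assumes "x \<in> {0..l}" "y \<in> {0..l}" shows "norm (u x - u y) \<le> \<bar>x - y\<bar> / R"
  using lipschitz_onD[OF lip assms] by (simp add: dist_norm dist_real_def)

lemma linearization:
  assumes S: "{p..q} \<subseteq> {0..l}" and "t \<in> {p..q}" "x \<in> {p..q}" "y \<in> {p..q}"
  shows "norm (\<gamma> y - \<gamma> x - (y - x) *\<^sub>R u t) \<le> \<bar>y - x\<bar> * ((q - p) / R)"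
proof -
  have "norm (\<gamma> y - \<gamma> x - (y - x) *\<^sub>R u t) \<le> norm (y - x) * ((q - p) / R)"
  proof (rule vector_differentiable_bound_linearization)
    show "(\<gamma> has_vector_derivative u z) (at z within {p..q})" if "z \<in> {p..q}" for z
      using deriv[of z] S that has_vector_derivative_within_subset by blast
    show "closed_segment x y \<subseteq> {p..q}" using assms by (auto simp: closed_segment_eq_real_ivl)
    show "t \<in> {p..q}" by fact
    fix z assume z: "z \<in> {p..q}"
    then have "norm (u z - u t) \<le> \<bar>z - t\<bar> / R" using S assms by (intro derivative_lipschitz) auto
    also have "\<dots> \<le> (q - p) / R" using z assms R by (intro divide_right_mono) auto
    finally show "norm (u z - u t) \<le> (q - p) / R" .
  qed
  then show ?thesis by simp
qed

text \<open>On a window of length \<open>h\<close> around \<open>t\<close> the curve is linear with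
  velocity \<open>u t\<close> up to a relative error \<open>h / R\<close>. Chords are at most arcs,
  which bounds the speed above; conversely \<open>norm (u t) + h / R\<close> times the parameter
  majorises all increments, so it grows at least as fast as arc length.\<close>

lemma unit_speed:
  assumes t: "t \<in> {0..l}" shows "norm (u t) = 1"
proof -
  have est: "norm (u t) \<le> 1 + e \<and> 1 \<le> norm (u t) + e" if e: "e > 0" for e
  proof -
    \<comment> \<open>The start \<open>p\<close> is shifted to the left where needed, so that the
      window stays in the domain when \<open>t\<close> is close to \<open>l\<close>.\<close>
    define h p where "h = min l (e * R)" and "p = min t (l - h)"
    have h: "h > 0" "h \<le> l" "h / R \<le> e" using l e R by (auto simp: h_def divide_le_eq)
    have p: "{p..p + h} \<subseteq> {0..l}" "t \<in> {p..p + h}" using t h by (auto simp: p_def)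
    have lin: "norm (\<gamma> y - \<gamma> x - (y - x) *\<^sub>R u t) \<le> (y - x) * (h / R)"
      if "x \<in> {p..p + h}" "y \<in> {p..p + h}" "x \<le> y" for x y
      using linearization[OF p that(1,2)] that(3) by simp
    have "norm (h *\<^sub>R u t) \<le> norm (\<gamma> (p + h) - \<gamma> p) + norm (\<gamma> (p + h) - \<gamma> p - h *\<^sub>R u t)"
      using norm_triangle_ineq4[of "\<gamma> (p + h) - \<gamma> p" "\<gamma> (p + h) - \<gamma> p - h *\<^sub>R u t"] by simp
    also have "norm (\<gamma> (p + h) - \<gamma> p) \<le> h"
      using natural_dist_le[OF nat, of p "p + h"] p h by (auto simp: dist_norm norm_minus_commute)
    also have "norm (\<gamma> (p + h) - \<gamma> p - h *\<^sub>R u t) \<le> h * (h / R)" using lin[of p "p + h"] h by simp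
    finally have "h * norm (u t) \<le> h * (1 + h / R)" using h by (simp add: algebra_simps)
    then have 1: "norm (u t) \<le> 1 + h / R" by (rule mult_left_le_imp_le) (rule h)
    have "(p + h) - p \<le> (norm (u t) + h / R) * (p + h) - (norm (u t) + h / R) * p"
    proof (rule natural_le_increment[OF nat])
      fix x y assume xy: "p \<le> x" "x \<le> y" "y \<le> p + h"
      have "norm (\<gamma> y - \<gamma> x) \<le> norm (\<gamma> y - \<gamma> x - (y - x) *\<^sub>R u t) + norm ((y - x) *\<^sub>R u t)"
        using norm_triangle_ineq[of "\<gamma> y - \<gamma> x - (y - x) *\<^sub>R u t" "(y - x) *\<^sub>R u t"] by simp
      also have "\<dots> \<le> (y - x) * (h / R) + (y - x) * norm (u t)"
        using lin[of x y] xy by (intro add_mono) auto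
      also have "(y - x) * k + (y - x) * n = (n + k) * y - (n + k) * x" for k n
        by (simp add: algebra_simps)
      finally show "dist (\<gamma> x) (\<gamma> y) \<le> (norm (u t) + h / R) * y - (norm (u t) + h / R) * x"
        by (simp only: dist_norm norm_minus_commute)
    qed (use p h in auto)
    also have "k * (p + h) - k * p = h * k" for k by (simp add: algebra_simps)
    finally have "h * 1 \<le> h * (norm (u t) + h / R)" by simp
    then have "1 \<le> norm (u t) + h / R" by (rule mult_left_le_imp_le) (rule h)
    with 1 h show ?thesis by linarith
  qed
  show ?thesis
  proof (rule order_antisym)
    show "norm (u t) \<le> 1" by (rule field_le_epsilon) (use est in blast)
    show "1 \<le> norm (u t)" by (rule field_le_epsilon) (use est in blast)
  qed
qed

text \<open>By the triangle inequality for angles, the angle to \<open>m\<close> changes by at most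
  the angle between two values of \<open>u\<close>. That angle agrees with the chord between them to
  first order, so the constant is locally \<open>k / R\<close> for every
  \<open>k > 1\<close>.\<close>

lemma angle_lipschitz:
  assumes m: "norm m = 1"
  shows "(1 / R)-lipschitz_on {0..l} (\<lambda>t. arccos (u t \<bullet> m))"
proof (rule lipschitz_on_of_larger_constants)
  fix k :: real assume k: "k > 1"
  obtain \<epsilon> where \<epsilon>: "\<epsilon> > 0" "\<And>y. 0 \<le> y \<Longrightarrow> y < \<epsilon> \<Longrightarrow> arcsin y \<le> k * y"
    by (rule arcsin_le_near_0[OF k]) (rule that)
  have bd: "\<bar>u t \<bullet> m\<bar> \<le> 1" if "t \<in> {0..l}" for t
    using Cauchy_Schwarz_ineq2[of "u t" m] unit_speed[OF that] m by simp
  have ineq: "arccos (u x \<bullet> m) \<le> arccos (u x \<bullet> u y) + arccos (u y \<bullet> m)"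
    if "x \<in> {0..l}" "y \<in> {0..l}" for x y
    using that m by (intro arccos_inner_triangle unit_speed)
  show "(1 / R * k)-lipschitz_on {0..l} (\<lambda>t. arccos (u t \<bullet> m))"
  proof (rule locally_lipschitz_imp_lipschitz)
    show "continuous_on {0..l} (\<lambda>t. arccos (u t \<bullet> m))"
      using lipschitz_on_continuous_on[OF lip] bd
      by (intro continuous_intros) (auto simp: abs_le_iff)
    fix s y assume s: "s \<in> {0..<l}" and y: "s < y"
    define h where "h = Min {y - s, l - s, \<epsilon> * R}"
    have h: "h > 0" using s y R \<epsilon> by (simp add: h_def)
    have "\<forall>z\<in>{y - s, l - s, \<epsilon> * R}. h \<le> z" unfolding h_def by (intro ballI Min_le) auto
    then have h': "h \<le> y - s" "h \<le> l - s" "h \<le> \<epsilon> * R" by blast+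
    define z where "z = s + h"
    have z: "z \<in> {0..l}" "s \<in> {0..l}" using s h h' by (auto simp: z_def)
    have d: "norm (u s - u z) \<le> h / R" using derivative_lipschitz[OF z(2,1)] h by (simp add: z_def)
    have "h / R \<le> \<epsilon>" using h' R by (simp add: divide_le_eq)
    then have "norm (u s - u z) / 2 < \<epsilon>" using d h R \<epsilon> by linarith
    then have "arcsin (norm (u s - u z) / 2) \<le> k * (norm (u s - u z) / 2)" by (intro \<epsilon>) auto
    then have "arccos (u s \<bullet> u z) \<le> k * norm (u s - u z)"
      using arccos_inner_eq_arcsin[OF unit_speed[OF z(2)] unit_speed[OF z(1)]] by simp
    also have "\<dots> \<le> k * (h / R)" using d k by (intro mult_left_mono) auto
    finally have "arccos (u s \<bullet> u z) \<le> 1 / R * k * h" by simp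
    then have "dist (arccos (u z \<bullet> m)) (arccos (u s \<bullet> m)) \<le> 1 / R * k * h"
      using ineq[OF z(2,1)] ineq[OF z] by (simp add: dist_real_def abs_le_iff inner_commute[of "u z" "u s"])
    then show "\<exists>z\<in>{s<..y}. dist (arccos (u z \<bullet> m)) (arccos (u s \<bullet> m)) \<le> 1 / R * k * (z - s)"
      using h h' by (intro bexI[of _ z]) (auto simp: z_def)
  qed (use R k in auto)
qed (use R in auto)

text \<open>The angle between \<open>u\<close> and a fixed direction \<open>m\<close> changes at most as fast as along a circle of
  radius \<open>R\<close>.\<close>

lemma inner_ge_cos:
  assumes m: "norm m = 1" and xy: "x \<in> {0..l}" "y \<in> {0..l}" and le: "arccos (u x \<bullet> m) + \<bar>y - x\<bar> / R \<le> pi"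
  shows "cos (arccos (u x \<bullet> m) + \<bar>y - x\<bar> / R) \<le> u y \<bullet> m"
proof -
  have bd: "\<bar>u y \<bullet> m\<bar> \<le> 1"
    using Cauchy_Schwarz_ineq2[of "u y" m] unit_speed[OF xy(2)] m by simp
  have "\<bar>arccos (u y \<bullet> m) - arccos (u x \<bullet> m)\<bar> \<le> \<bar>y - x\<bar> / R"
    using lipschitz_onD[OF angle_lipschitz[OF m] xy(2,1)] by (simp add: dist_real_def)
  then have "cos (arccos (u x \<bullet> m) + \<bar>y - x\<bar> / R) \<le> cos (arccos (u y \<bullet> m))"
    using bd le by (intro cos_monotone_0_pi_le) (auto simp: abs_le_iff arccos_lbound)
  then show ?thesis using bd by (simp add: cos_arccos_abs)
qed

lemma inner_le_cos:
  assumes m: "norm m = 1" and xy: "x \<in> {0..l}" "y \<in> {0..l}" and le: "\<bar>y - x\<bar> / R \<le> arccos (u x \<bullet> m)"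
  shows "u y \<bullet> m \<le> cos (arccos (u x \<bullet> m) - \<bar>y - x\<bar> / R)"
proof -
  have bd: "\<bar>u y \<bullet> m\<bar> \<le> 1"
    using Cauchy_Schwarz_ineq2[of "u y" m] unit_speed[OF xy(2)] m by simp
  have "\<bar>arccos (u y \<bullet> m) - arccos (u x \<bullet> m)\<bar> \<le> \<bar>y - x\<bar> / R"
    using lipschitz_onD[OF angle_lipschitz[OF m] xy(2,1)] by (simp add: dist_real_def)
  then have "cos (arccos (u y \<bullet> m)) \<le> cos (arccos (u x \<bullet> m) - \<bar>y - x\<bar> / R)"
    using bd le by (intro cos_monotone_0_pi_le) (auto simp: abs_le_iff arccos_ubound)
  then show ?thesis using bd by (simp add: cos_arccos_abs)
qed

lemma inner_increment_le:
  assumes st: "0 \<le> s" "s \<le> t" "t \<le> l"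
    and G: "\<And>x. s \<le> x \<Longrightarrow> x \<le> t \<Longrightarrow> (G has_real_derivative G' x) (at x within {s..t})"
    and le: "\<And>x. s \<le> x \<Longrightarrow> x \<le> t \<Longrightarrow> u x \<bullet> m \<le> G' x"
  shows "(\<gamma> t - \<gamma> s) \<bullet> m \<le> G t - G s"
proof -
  define H where "H = (\<lambda>x. G x - \<gamma> x \<bullet> m)"
  have "\<exists>x\<in>{s..t}. H t - H s = (\<lambda>h. G' x * h - (h *\<^sub>R u x) \<bullet> m) (t - s)"
  proof (rule mvt_very_simple[OF st(2)])
    fix x assume x: "s \<le> x" "x \<le> t"
    have "(\<gamma> has_derivative (\<lambda>h. h *\<^sub>R u x)) (at x within {s..t})"
      using deriv[of x] x st unfolding has_vector_derivative_def
      by (auto intro: has_derivative_subset)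
    moreover have "(G has_derivative (\<lambda>h. G' x * h)) (at x within {s..t})"
      using G[OF x] by (simp add: has_field_derivative_def)
    ultimately show "(H has_derivative (\<lambda>h. G' x * h - (h *\<^sub>R u x) \<bullet> m)) (at x within {s..t})"
      unfolding H_def by (intro has_derivative_diff has_derivative_inner_left)
  qed
  then obtain x where x: "x \<in> {s..t}" "H t - H s = (G' x - u x \<bullet> m) * (t - s)"
    by (auto simp: algebra_simps)
  have "0 \<le> (G' x - u x \<bullet> m) * (t - s)" using x le[of x] st by (intro mult_nonneg_nonneg) auto
  with x show ?thesis by (simp add: H_def inner_simps)
qed

lemma inner_increment_ge:
  assumes st: "0 \<le> s" "s \<le> t" "t \<le> l"
    and G: "\<And>x. s \<le> x \<Longrightarrow> x \<le> t \<Longrightarrow> (G has_real_derivative G' x) (at x within {s..t})"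
    and le: "\<And>x. s \<le> x \<Longrightarrow> x \<le> t \<Longrightarrow> G' x \<le> u x \<bullet> m"
  shows "G t - G s \<le> (\<gamma> t - \<gamma> s) \<bullet> m"
proof -
  have "((\<lambda>x. - G x) has_real_derivative - G' x) (at x within {s..t})" if "s \<le> x" "x \<le> t" for x
    using G[OF that] by (rule DERIV_minus)
  from inner_increment_le[OF st this, of "- m"] le show ?thesis by simp
qed

text \<open>Test with the tangent at the midpoint \<open>c\<close>: there the velocity component is
  at least \<open>cos ((x - c) / R)\<close>, as on a circle of radius \<open>R\<close>. Integration
  gives the chord of the circular arc of the same length.\<close>

lemma chord_ge_sin:
  assumes st: "0 \<le> s" "s \<le> t" "t \<le> l"
  shows "2 * R * sin ((t - s) / (2 * R)) \<le> norm (\<gamma> t - \<gamma> s)"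
proof -
  define c where "c = (s + t) / 2"
  have c: "c \<in> {0..l}" using st by (auto simp: c_def)
  define G where "G = (\<lambda>x. R * sin ((x - c) / R))"
  have "G t - G s \<le> (\<gamma> t - \<gamma> s) \<bullet> u c"
  proof (rule inner_increment_ge[OF st])
    fix x assume x: "s \<le> x" "x \<le> t"
    show "(G has_real_derivative cos ((x - c) / R)) (at x within {s..t})"
      unfolding G_def using R by (auto intro!: derivative_eq_intros)
    have one: "u c \<bullet> u c = 1" using unit_speed[OF c] by (simp add: dot_square_norm)
    have "\<bar>x - c\<bar> \<le> t - s" using x by (auto simp: c_def abs_le_iff field_simps)
    then have "\<bar>x - c\<bar> \<le> pi * R" using st lR by linarith
    then have "\<bar>x - c\<bar> / R \<le> pi" using R by (simp add: divide_le_eq)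
    then have "cos (\<bar>x - c\<bar> / R) \<le> u x \<bullet> u c"
      using inner_ge_cos[OF unit_speed[OF c] c, of x] x st one by simp
    moreover have "cos (\<bar>x - c\<bar> / R) = cos ((x - c) / R)"
      using R cos_abs_real[of "(x - c) / R"] by simp
    ultimately show "cos ((x - c) / R) \<le> u x \<bullet> u c" by simp
  qed
  moreover have "G t - G s = 2 * R * sin ((t - s) / (2 * R))"
  proof -
    have "(t - c) / R = (t - s) / (2 * R)" "(s - c) / R = - ((t - s) / (2 * R))"
      using R by (simp_all add: c_def field_simps)
    then show ?thesis by (simp add: G_def)
  qed
  ultimately show ?thesis
    using norm_cauchy_schwarz[of "\<gamma> t - \<gamma> s" "u c"] unit_speed[OF c] by simp
qed

text \<open>The same comparison with the tangent at the start gives at least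
  \<open>R * sin ((t - s) / R)\<close>, which is nonnegative because the arc is no longer than a
  half circle.\<close>

lemma chord_inner_tangent_nonneg:
  assumes st: "0 \<le> s" "s \<le> t" "t \<le> l"
  shows "0 \<le> (\<gamma> t - \<gamma> s) \<bullet> u s"
proof -
  have s: "s \<in> {0..l}" using st by auto
  define G where "G = (\<lambda>x. R * sin ((x - s) / R))"
  have "G t - G s \<le> (\<gamma> t - \<gamma> s) \<bullet> u s"
  proof (rule inner_increment_ge[OF st])
    fix x assume x: "s \<le> x" "x \<le> t"
    show "(G has_real_derivative cos ((x - s) / R)) (at x within {s..t})"
      unfolding G_def using R by (auto intro!: derivative_eq_intros)
    have one: "u s \<bullet> u s = 1" using unit_speed[OF s] by (simp add: dot_square_norm)
    have "(x - s) / R \<le> pi" using x st lR R by (simp add: divide_le_eq)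
    then show "cos ((x - s) / R) \<le> u x \<bullet> u s"
      using inner_ge_cos[OF unit_speed[OF s] s, of x] x st one by simp
  qed
  moreover have "0 \<le> G t - G s"
    using st lR R by (auto simp: G_def divide_le_eq intro!: mult_nonneg_nonneg sin_ge_zero)
  ultimately show ?thesis by linarith
qed

text \<open>The test direction \<open>m\<close> is normal to the chord of the circle of radius \<open>R\<close> that starts tangentially
  to \<open>u s\<close>, bends towards \<open>n\<close> and has the same length as the arc.\<close>

lemma chord_inner_normal_le:
  assumes st: "0 \<le> s" "s \<le> t" "t \<le> l" and n: "norm n = 1" "n \<bullet> u s = 0"
  defines "\<phi> \<equiv> (t - s) / (2 * R)" and "w \<equiv> \<gamma> t - \<gamma> s"
  shows "(w \<bullet> n) * cos \<phi> \<le> (w \<bullet> u s) * sin \<phi>"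
proof -
  have s: "s \<in> {0..l}" using st by auto
  have \<phi>: "0 \<le> \<phi>" "\<phi> \<le> pi / 2" using st lR R by (auto simp: \<phi>_def divide_le_eq)
  have one: "u s \<bullet> u s = 1" "n \<bullet> n = 1" using unit_speed[OF s] n by (simp_all add: dot_square_norm)
  define m where "m = cos \<phi> *\<^sub>R n - sin \<phi> *\<^sub>R u s"
  have "(norm m)\<^sup>2 = (cos \<phi>)\<^sup>2 + (sin \<phi>)\<^sup>2"
    unfolding power2_norm_eq_inner using one n
    by (simp add: m_def inner_simps inner_commute power2_eq_square)
  then have m: "norm m = 1" using power2_eq_imp_eq[of "norm m" 1] by simp
  have "u s \<bullet> m = - sin \<phi>" using one n by (simp add: m_def inner_simps inner_commute)
  also have "\<dots> = cos (pi / 2 + \<phi>)" by (simp add: cos_add)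
  finally have ang: "arccos (u s \<bullet> m) = pi / 2 + \<phi>" using \<phi> by (simp add: arccos_cos)
  \<comment> \<open>\<open>G\<close> is, up to a constant, the component along \<open>m\<close> of
    the comparison circle, whose tangent starts at angle \<open>pi / 2 + \<phi>\<close> to
    \<open>m\<close> and turns at rate \<open>1 / R\<close> to \<open>pi / 2 - \<phi>\<close>. Its
    total increment vanishes since \<open>m\<close> is normal to the chord of that circle.\<close>
  define G where "G = (\<lambda>x. - R * cos ((x - s) / R - \<phi>))"
  have "w \<bullet> m \<le> G t - G s"
    unfolding w_def
  proof (rule inner_increment_le[OF st])
    fix x assume x: "s \<le> x" "x \<le> t"
    show "(G has_real_derivative sin ((x - s) / R - \<phi>)) (at x within {s..t})"
      unfolding G_def using R by (auto intro!: derivative_eq_intros)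
    have "(x - s) / R \<le> (t - s) / R" using x R by (intro divide_right_mono) auto
    also have "\<dots> = 2 * \<phi>" using R by (simp add: \<phi>_def field_simps)
    also have "\<dots> \<le> pi / 2 + \<phi>" using \<phi> by simp
    finally have "u x \<bullet> m \<le> cos (pi / 2 + \<phi> - (x - s) / R)"
      using inner_le_cos[OF m s, of x] x st ang by simp
    also have "\<dots> = sin ((x - s) / R - \<phi>)"
      by (simp add: cos_sin_eq diff_diff_eq2 add_diff_eq)
    finally show "u x \<bullet> m \<le> sin ((x - s) / R - \<phi>)" .
  qed
  also have "G t - G s = 0"
  proof -
    have "(t - s) / R - \<phi> = \<phi>" by (simp add: \<phi>_def field_simps)
    then show ?thesis by (simp add: G_def)
  qed
  finally show ?thesis by (simp add: m_def inner_simps inner_commute mult.commute)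
qed

text \<open>Combining \<open>chord_inner_normal_le\<close> with Bessel's inequality bounds a
  positive normal component by \<open>norm w * sin \<phi>\<close>, and \<open>chord_ge_sin\<close>
  gives \<open>2 * R * sin \<phi> \<le> norm w\<close>. The resulting product says that
  \<open>\<gamma> t\<close> is outside the open ball of radius \<open>R\<close> about
  \<open>\<gamma> s + R *\<^sub>R n\<close>.\<close>

lemma tangent_ball_avoids_arc:
  assumes st: "0 \<le> s" "s \<le> t" "t \<le> l" and n: "norm n = 1" "n \<bullet> u s = 0"
  shows "2 * R * ((\<gamma> t - \<gamma> s) \<bullet> n) \<le> (norm (\<gamma> t - \<gamma> s))\<^sup>2"
proof -
  define w \<phi> where "w = \<gamma> t - \<gamma> s" and "\<phi> = (t - s) / (2 * R)"
  have s: "s \<in> {0..l}" using st by auto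
  have \<phi>: "0 \<le> \<phi>" "\<phi> \<le> pi / 2" using st lR R by (auto simp: \<phi>_def divide_le_eq)
  have trig: "0 \<le> sin \<phi>" "0 \<le> cos \<phi>" using \<phi> by (auto intro: sin_ge_zero cos_ge_zero)
  define a b where "a = w \<bullet> u s" and "b = w \<bullet> n"
  show ?thesis
  proof (cases "b \<le> 0")
    case True
    then have "2 * R * b \<le> 0" using R by (simp add: mult_le_0_iff)
    then show ?thesis unfolding b_def w_def by (rule order_trans) simp
  next
    case False
    have one: "u s \<bullet> u s = 1" "n \<bullet> n = 1" using unit_speed[OF s] n by (simp_all add: dot_square_norm)
    have "0 \<le> (norm (w - a *\<^sub>R u s - b *\<^sub>R n))\<^sup>2" by simp
    also have "\<dots> = (norm w)\<^sup>2 - a\<^sup>2 - b\<^sup>2"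
      unfolding power2_norm_eq_inner using one n
      by (simp add: inner_simps inner_commute power2_eq_square a_def b_def)
    finally have bessel: "a\<^sup>2 + b\<^sup>2 \<le> (norm w)\<^sup>2" by simp
    have "b * cos \<phi> \<le> a * sin \<phi>"
      using chord_inner_normal_le[OF st n] by (simp add: a_def b_def w_def \<phi>_def)
    then have "(b * cos \<phi>)\<^sup>2 \<le> (a * sin \<phi>)\<^sup>2" using False trig by (intro power_mono) auto
    have "b\<^sup>2 = b\<^sup>2 * ((cos \<phi>)\<^sup>2 + (sin \<phi>)\<^sup>2)" by simp
    also have "\<dots> = (b * cos \<phi>)\<^sup>2 + b\<^sup>2 * (sin \<phi>)\<^sup>2" by (simp only: distrib_left power_mult_distrib)
    also have "\<dots> \<le> (a * sin \<phi>)\<^sup>2 + b\<^sup>2 * (sin \<phi>)\<^sup>2" by (intro add_right_mono) fact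
    also have "\<dots> = (a\<^sup>2 + b\<^sup>2) * (sin \<phi>)\<^sup>2" by (simp only: distrib_right power_mult_distrib)
    also have "\<dots> \<le> (norm w)\<^sup>2 * (sin \<phi>)\<^sup>2" using bessel by (intro mult_right_mono) auto
    finally have "b\<^sup>2 \<le> (norm w * sin \<phi>)\<^sup>2" by (simp add: power_mult_distrib)
    then have "b \<le> norm w * sin \<phi>" by (rule power2_le_imp_le) (use trig in auto)
    then have "2 * R * b \<le> 2 * R * (norm w * sin \<phi>)" using R by (intro mult_left_mono) auto
    also have "\<dots> = norm w * (2 * R * sin \<phi>)" by simp
    also have "\<dots> \<le> norm w * norm w"
      using chord_ge_sin[OF st] by (intro mult_left_mono) (auto simp: w_def \<phi>_def)
    finally show ?thesis by (simp add: b_def w_def power2_eq_square)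
  qed
qed

text \<open>First variation: were the component positive, a small step forward along the arc would
  come closer to \<open>x\<close>. At \<open>s = 0\<close> only forward steps exist, hence an
  inequality.\<close>

lemma nearest_inner_tangent_le:
  assumes s: "0 \<le> s" "s < l" and near: "nearest (\<gamma> ` {0..l}) x (\<gamma> s)"
  shows "(x - \<gamma> s) \<bullet> u s \<le> 0"
proof (rule ccontr)
  define N \<kappa> where "N = x - \<gamma> s" and "\<kappa> = N \<bullet> u s"
  assume "\<not> ?thesis"
  then have \<kappa>: "\<kappa> > 0" by (simp add: \<kappa>_def N_def)
  \<comment> \<open>\<open>h\<^sup>2 * B\<close> collects the second-order errors, namely the
    squared chord and the linearisation error paired with \<open>N\<close>. The choice of
    \<open>h\<close> makes it at most \<open>h * \<kappa>\<close>, below the first-order gain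
    \<open>2 * h * \<kappa>\<close>.\<close>
  define B where "B = 1 + 2 * norm N / R"
  have B: "B \<ge> 1" using R by (simp add: B_def)
  define h where "h = min (l - s) (\<kappa> / B)"
  have h: "h > 0" "h \<le> l - s" using s \<kappa> B by (auto simp: h_def)
  have "h \<le> \<kappa> / B" by (simp add: h_def)
  then have hB: "h * B \<le> \<kappa>" using B by (simp add: le_divide_eq)
  define w where "w = \<gamma> (s + h) - \<gamma> s"
  have mem: "\<gamma> (s + h) \<in> \<gamma> ` {0..l}" using s h by (intro imageI) auto
  have "norm N \<le> norm (N - w)"
    using near infdist_le[OF mem, of x] by (simp add: nearest_def dist_norm N_def w_def)
  then have "(norm N)\<^sup>2 \<le> (norm (N - w))\<^sup>2" by (intro power_mono) auto
  then have 1: "2 * (N \<bullet> w) \<le> (norm w)\<^sup>2"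
    unfolding power2_norm_eq_inner by (simp add: inner_simps inner_commute)
  have "norm w \<le> h"
    using natural_dist_le[OF nat, of s "s + h"] s h by (simp add: w_def dist_norm norm_minus_commute)
  then have 2: "(norm w)\<^sup>2 \<le> h\<^sup>2" by (intro power_mono) auto
  have "norm (w - h *\<^sub>R u s) \<le> h * (h / R)"
    using linearization[of s "s + h" s s "s + h"] s h by (simp add: w_def)
  then have "norm N * norm (w - h *\<^sub>R u s) \<le> norm N * (h * (h / R))" by (intro mult_left_mono) auto
  moreover have "h * \<kappa> - N \<bullet> w \<le> norm N * norm (w - h *\<^sub>R u s)"
    using norm_cauchy_schwarz[of N "h *\<^sub>R u s - w"]
    by (simp add: \<kappa>_def inner_simps norm_minus_commute)
  ultimately have "2 * (h * \<kappa>) \<le> h\<^sup>2 + 2 * (norm N * (h * (h / R)))" using 1 2 by linarith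
  also have "\<dots> = h * (h * B)" by (simp add: B_def power2_eq_square algebra_simps)
  also have "\<dots> \<le> h * \<kappa>" using hB h by (intro mult_left_mono) auto
  finally show False using h \<kappa> by (simp add: mult_le_0_iff)
qed

text \<open>Look from the earlier \<open>\<gamma> s\<close> of two nearest points. Equal distances
  mean \<open>(norm w)\<^sup>2 = 2 * (w \<bullet> N)\<close>. Along \<open>u s\<close> the offset
  \<open>N\<close> has a nonpositive and the chord \<open>w\<close> a nonnegative component, so
  dropping the tangential part of \<open>N\<close> does not decrease the product. The normal part
  \<open>N'\<close> is shorter than \<open>R\<close>, which contradicts
  \<open>tangent_ball_avoids_arc\<close>.\<close>

lemma arc_unique_nearest:
  assumes x: "infdist x (\<gamma> ` {0..l}) < R"
    and p: "nearest (\<gamma> ` {0..l}) x p" and q: "nearest (\<gamma> ` {0..l}) x q"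
  shows "p = q"
proof -
  have no: False
    if st: "0 \<le> s" "s < t" "t \<le> l"
      and near: "nearest (\<gamma> ` {0..l}) x (\<gamma> s)" "nearest (\<gamma> ` {0..l}) x (\<gamma> t)" for s t
  proof -
    define N w where "N = x - \<gamma> s" and "w = \<gamma> t - \<gamma> s"
    have s: "s \<in> {0..l}" using st by auto
    have NR: "norm N < R" using near x by (simp add: nearest_def dist_norm N_def)
    have "w \<noteq> 0" using inj_onD[OF inj, of t s] st by (auto simp: w_def)
    have "norm N = norm (N - w)" using near by (simp add: nearest_def dist_norm N_def w_def)
    then have "(norm N)\<^sup>2 = (norm (N - w))\<^sup>2" by simp
    then have eq: "(norm w)\<^sup>2 = 2 * (w \<bullet> N)"
      unfolding power2_norm_eq_inner by (simp add: inner_simps inner_commute)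
    have one: "u s \<bullet> u s = 1" using unit_speed[OF s] by (simp add: dot_square_norm)
    define N' where "N' = N - (N \<bullet> u s) *\<^sub>R u s"
    have N'u: "N' \<bullet> u s = 0" by (simp add: N'_def inner_simps one)
    have "N \<bullet> u s \<le> 0" using nearest_inner_tangent_le[OF st(1) _ near(1)] st by (simp add: N_def)
    then have "(N \<bullet> u s) * (w \<bullet> u s) \<le> 0"
      using chord_inner_tangent_nonneg[of s t] st by (intro mult_nonpos_nonneg) (auto simp: w_def)
    then have wN: "w \<bullet> N \<le> w \<bullet> N'" by (simp add: N'_def inner_simps)
    have "(norm N')\<^sup>2 = (norm N)\<^sup>2 - (N \<bullet> u s)\<^sup>2"
      unfolding power2_norm_eq_inner by (simp add: N'_def inner_simps inner_commute one power2_eq_square)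
    then have "(norm N')\<^sup>2 \<le> (norm N)\<^sup>2" by simp
    then have "norm N' \<le> norm N" by (rule power2_le_imp_le) simp
    then have N'R: "norm N' < R" using NR by simp
    have w2: "(norm w)\<^sup>2 > 0" using \<open>w \<noteq> 0\<close> by simp
    have "N' \<noteq> 0" using wN eq w2 by auto
    define n where "n = (1 / norm N') *\<^sub>R N'"
    have n: "norm n = 1" "n \<bullet> u s = 0" "N' = norm N' *\<^sub>R n" using \<open>N' \<noteq> 0\<close> N'u by (auto simp: n_def)
    have "w \<bullet> N' = norm N' * (w \<bullet> n)" by (subst n(3)) simp
    then have "R * (norm w)\<^sup>2 \<le> norm N' * (2 * R * (w \<bullet> n))"
      using eq wN R mult_left_mono[of "(norm w)\<^sup>2" "2 * (w \<bullet> N')" R] by (simp add: mult_ac)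
    also have "\<dots> \<le> norm N' * (norm w)\<^sup>2"
      using tangent_ball_avoids_arc[OF st(1) _ st(3) n(1,2)] st by (intro mult_left_mono) (auto simp: w_def)
    also have "\<dots> < R * (norm w)\<^sup>2" using N'R w2 by (rule mult_strict_right_mono)
    finally show False by simp
  qed
  obtain s t where st: "s \<in> {0..l}" "t \<in> {0..l}" "p = \<gamma> s" "q = \<gamma> t"
    using p q by (auto simp: nearest_def)
  show ?thesis
    using no[of s t] no[of t s] st p q by (cases s t rule: linorder_cases) auto
qed

end

theorem theorem1p3:
  fixes \<Gamma> :: "real \<Rightarrow> 'a::{real_inner, complete_space}"
    and R l :: real
    and a b :: 'a
  assumes dim_ge_2: "\<exists>B :: 'a set. independent B \<and> finite B \<and> card B = 2"
    and R_pos: "R > 0"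
    and rectifiable: "rectifiable_curve \<Gamma> 0 l"
    and natural: "natural_parametrization \<Gamma> l"
    and no_self_intersections: "inj_on \<Gamma> {0..l}"
    and length_le: "curve_length \<Gamma> 0 l \<le> ennreal (pi * R)"
    and endpoints: "\<Gamma> 0 = a" "\<Gamma> l = b"
    and chord: "0 < norm (a - b)" "norm (a - b) < 2 * R"
  shows "proximally_smooth R (\<Gamma> ` {0..l}) \<longleftrightarrow>
    ((\<forall>t\<in>{0..l}. \<Gamma> differentiable (at t within {0..l})) \<and>
     (1 / R)-lipschitz_on {0..l} (\<lambda>t. vector_derivative \<Gamma> (at t within {0..l})))"
proof -
  have "l \<noteq> 0" using endpoints chord by auto
  then have l: "0 < l" using natural by (auto simp: natural_parametrization_def)
  have cont: "continuous_on {0..l} \<Gamma>" using rectifiable by (simp add: rectifiable_curve_def)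
  have "ennreal l \<le> ennreal (pi * R)"
    using length_le natural l by (auto simp: natural_parametrization_def)
  then have lR: "l \<le> pi * R" using R_pos by (simp add: ennreal_le_iff)
  show ?thesis
  proof
    assume "proximally_smooth R (\<Gamma> ` {0..l})"
    then show "(\<forall>t\<in>{0..l}. \<Gamma> differentiable (at t within {0..l})) \<and>
        (1 / R)-lipschitz_on {0..l} (\<lambda>t. vector_derivative \<Gamma> (at t within {0..l}))"
      by (intro natural_parametrization_C11[OF l R_pos natural cont no_self_intersections])
        (auto simp: proximally_smooth_def continuously_differentiable_on_def differentiable_def)
  next
    assume *: "(\<forall>t\<in>{0..l}. \<Gamma> differentiable (at t within {0..l})) \<and>
        (1 / R)-lipschitz_on {0..l} (\<lambda>t. vector_derivative \<Gamma> (at t within {0..l}))"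
    show "proximally_smooth R (\<Gamma> ` {0..l})"
    proof (rule proximally_smooth_of_unique_nearest)
      show "compact (\<Gamma> ` {0..l})" using cont by (auto intro: compact_continuous_image)
      show "\<Gamma> ` {0..l} \<noteq> {}" using l by simp
    next
      fix x p q
      assume "infdist x (\<Gamma> ` {0..l}) < R" "nearest (\<Gamma> ` {0..l}) x p" "nearest (\<Gamma> ` {0..l}) x q"
      then show "p = q"
        using * by (intro arc_unique_nearest[OF l R_pos lR natural no_self_intersections])
          (auto simp: vector_derivative_works)
    qed
  qed
qed

end
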